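(* BR and $\mathsf D$ are equivalent over (finite) data words: for every BR sentence there is a cascade in $\mathsf D$ accepting exactly the data words satisfying it, and for every cascade in $\mathsf D$ there is a BR sentence satisfied by exactly the data words it accepts.
   Context: Data words: finite sequences $w=(a_1,d_1)\cdots(a_n,d_n)$ over $\Sigma\times\mathcal D$ ($\Sigma$ finite, $\mathcal D$ infinite); $i\sim j$ iff $d_i=d_j$; class successor/predecessor of $i$: nearest later/earlier $j\sim i$. $\mu$-calculus: $\varphi::= x\mid A\mid\neg A\mid \mathsf M\varphi\mid\varphi\vee\varphi\mid\varphi\wedge\varphi\mid\mu x.\varphi\mid\nu x.\varphi$, atoms $A$: letters and $\mathsf S,\mathsf P,\mathsf{first}^g,\mathsf{last}^g,\mathsf{first}^c,\mathsf{last}^c$; $\mathsf M\in\{\mathtt X^g,\mathtt X^c,\mathtt Y^g,\mathtt Y^c\}$ evaluating the argument at successor, class successor, predecessor, class predecessor (false if nonexistent); $\mathsf{first}^g$/$\mathsf{last}^g$ at first/last position; $\mathsf{first}^c$/$\mathsf{last}^c$ where no class predecessor/successor; $\mathsf S$ at $i$ iff $i$ not last and $i+1$ is the class successor of $i$; $\mathsf P$ at $i$ iff $i\ne1$ and $i-1$ is the class predecessor of $i$; $\mu,\nu$ least/greatest fixpoints; $w\models\varphi$ iff $\varphi$ holds at position 1. $\mathsf{Formulas}(M)$: formulas whose unary modalities lie in $M$. $\mathsf{Comp}^0(\Psi)=\emptyset$, $\mathsf{Comp}^{i+1}(\Psi)=\{\psi(\varphi_1,\dots,\varphi_n)\mid\psi(x_1,\dots,x_n)\in\Psi,\varphi_j\in\mathsf{Comp}^i(\Psi)\}$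 (capture-avoiding), $\mathsf{Comp}(\Psi)=\bigcup_i\mathsf{Comp}^i(\Psi)$. BR $=\mathsf{Comp}(\mathsf{Formulas}(\{\mathtt X^c,\mathtt X^g\})\cup\mathsf{Formulas}(\{\mathtt Y^c,\mathtt Y^g\}))$. Marking alphabet $\mathcal M=\{\mathsf P,\neg\mathsf P\}\times\{\mathsf S,\neg\mathsf S\}$; type $\mathrm{tp}(i)=(p,s)$ with $s=\mathsf S$ iff $i$ not last and $i+1$ is the class successor of $i$, $p=\mathsf P$ iff $i\neq1$ and $i-1$ is the class predecessor of $i$. A deterministic class-memory transducer (CMT) is $(Q,\Sigma,\Sigma',\Delta,q_0,F_c,F_g)$ with finite state set $Q$, input alphabet $\Sigma$, output alphabet $\Sigma'$, transition function $\Delta: Q\times(Q\cup\{\top,\bot\})\times\Sigma\times\mathcal M\to Q\times\Sigma'$, initial state $q_0$, class-final states $F_c$ and global-final states $F_g$. A forward CMT on $w$: a run is $q_0q_1\cdots q_n$ with outputs $a'_1\cdots a'_n$ such that for each $i$, $\Delta(q_{i-1},m,a_i,\mathrm{tp}(i))=(q_i,a'_i)$ where $m=\bot$ if $i$ has no class predecessor and $m=q_j$ if $j$ is the class predecessor of $i$; it is successful if $q_n\in F_g$ and $q_i\in F_c$ for every position $i$ with no class successor. A backward CMT processes positions in order $n,n-1,\dots,1$: the state after position $i$ is $q_{n-i+1}$, with $\Delta(q_{n-i},m,a_i,\mathrm{tp}(i))=(q_{n-i+1},a'_i)$ where $m=\top$ if $i$ has no class successor and $m=q_{n-j+1}$ if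 $j$ is the class successor of $i$; successful if $q_n\in F_g$ and $q_{n-i+1}\in F_c$ for every $i$ with no class predecessor. The output data word is $(a'_1,d_1)\cdots(a'_n,d_n)$. A cascade $\langle\Sigma_0,\mathcal A_1,\Sigma_1,\dots,\mathcal A_n,\Sigma_n\rangle$ consists of forward and backward CMTs, $\mathcal A_i$ with input alphabet $\Sigma_{i-1}$ and output $\Sigma_i$; its height is $n$; it accepts $w$ iff, with $w_0=w$, each $\mathcal A_i$ has a successful run on $w_{i-1}$ producing $w_i$. $\mathsf D$ is the set of all such cascades. *)

theory Defs
  imports Main
begin

section \<open>Data words\<close>

text \<open>Positions are the list indices, so they start at 0. Words are nonempty, because satisfaction
  of a sentence is evaluated at the first position.\<close>

type_synonym ('a, 'd) data_word = "('a \<times> 'd) list"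

definition data_words :: "'a set \<Rightarrow> ('a, 'd) data_word set" where
  "data_words \<Sigma> = {w. w \<noteq> [] \<and> fst ` set w \<subseteq> \<Sigma>}"

definition same_class :: "('a, 'd) data_word \<Rightarrow> nat \<Rightarrow> nat \<Rightarrow> bool" where
  "same_class w i j \<longleftrightarrow> snd (w ! i) = snd (w ! j)"

definition class_succ :: "('a, 'd) data_word \<Rightarrow> nat \<Rightarrow> nat option" where
  "class_succ w i =
     (if \<exists>j. i < j \<and> j < length w \<and> same_class w i j
      then Some (LEAST j. i < j \<and> j < length w \<and> same_class w i j) else None)"

definition class_pred :: "('a, 'd) data_word \<Rightarrow> nat \<Rightarrow> nat option" where
  "class_pred w i =
     (if \<exists>j. j < i \<and> same_class w i j
      then Some (GREATEST j. j < i \<and> same_class w i j) else None)"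

definition succ_in_class :: "('a, 'd) data_word \<Rightarrow> nat \<Rightarrow> bool" where
  "succ_in_class w i \<longleftrightarrow> i + 1 < length w \<and> class_succ w i = Some (i + 1)"

definition pred_in_class :: "('a, 'd) data_word \<Rightarrow> nat \<Rightarrow> bool" where
  "pred_in_class w i \<longleftrightarrow> i \<noteq> 0 \<and> class_pred w i = Some (i - 1)"


section \<open>The \<open>\<mu>\<close>-calculus\<close>

datatype 'a atom = Letter 'a | AtomS | AtomP | FirstG | LastG | FirstC | LastC

datatype modality = Xg | Xc | Yg | Yc

datatype 'a form =
    Var nat
  | Atom "'a atom"
  | NegAtom "'a atom"
  | Mod modality "'a form"
  | Or "'a form" "'a form"
  | And "'a form" "'a form"
  | Mu nat "'a form"
  | Nu nat "'a form"

fun atom_holds :: "('a, 'd) data_word \<Rightarrow> 'a atom \<Rightarrow> nat \<Rightarrow> bool" where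
  "atom_holds w (Letter a) i \<longleftrightarrow> fst (w ! i) = a"
| "atom_holds w AtomS i \<longleftrightarrow> succ_in_class w i"
| "atom_holds w AtomP i \<longleftrightarrow> pred_in_class w i"
| "atom_holds w FirstG i \<longleftrightarrow> i = 0"
| "atom_holds w LastG i \<longleftrightarrow> i + 1 = length w"
| "atom_holds w FirstC i \<longleftrightarrow> class_pred w i = None"
| "atom_holds w LastC i \<longleftrightarrow> class_succ w i = None"

fun target :: "('a, 'd) data_word \<Rightarrow> modality \<Rightarrow> nat \<Rightarrow> nat option" where
  "target w Xg i = (if i + 1 < length w then Some (i + 1) else None)"
| "target w Xc i = class_succ w i"
| "target w Yg i = (if i \<noteq> 0 then Some (i - 1) else None)"
| "target w Yc i = class_pred w i"

text \<open>Intersecting the value of a variable with the set of positions makes the fixpoints, formed in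
  the lattice of all sets of naturals, agree with those in the lattice of sets of positions.\<close>

primrec sem :: "('a, 'd) data_word \<Rightarrow> (nat \<Rightarrow> nat set) \<Rightarrow> 'a form \<Rightarrow> nat set" where
  "sem w V (Var x) = {i. i < length w \<and> i \<in> V x}"
| "sem w V (Atom A) = {i. i < length w \<and> atom_holds w A i}"
| "sem w V (NegAtom A) = {i. i < length w \<and> \<not> atom_holds w A i}"
| "sem w V (Mod m \<phi>) = {i. i < length w \<and> (\<exists>j. target w m i = Some j \<and> j \<in> sem w V \<phi>)}"
| "sem w V (Or \<phi> \<psi>) = sem w V \<phi> \<union> sem w V \<psi>"
| "sem w V (And \<phi> \<psi>) = sem w V \<phi> \<inter> sem w V \<psi>"
| "sem w V (Mu x \<phi>) = lfp (\<lambda>X. sem w (V(x := X)) \<phi>)"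
| "sem w V (Nu x \<phi>) = gfp (\<lambda>X. sem w (V(x := X)) \<phi>)"

primrec free_vars :: "'a form \<Rightarrow> nat set" where
  "free_vars (Var x) = {x}"
| "free_vars (Atom A) = {}"
| "free_vars (NegAtom A) = {}"
| "free_vars (Mod m \<phi>) = free_vars \<phi>"
| "free_vars (Or \<phi> \<psi>) = free_vars \<phi> \<union> free_vars \<psi>"
| "free_vars (And \<phi> \<psi>) = free_vars \<phi> \<union> free_vars \<psi>"
| "free_vars (Mu x \<phi>) = free_vars \<phi> - {x}"
| "free_vars (Nu x \<phi>) = free_vars \<phi> - {x}"

definition sentence :: "'a form \<Rightarrow> bool" where
  "sentence \<phi> \<longleftrightarrow> free_vars \<phi> = {}"

text \<open>For a sentence the valuation is irrelevant.\<close>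

definition models :: "('a, 'd) data_word \<Rightarrow> 'a form \<Rightarrow> bool" where
  "models w \<phi> \<longleftrightarrow> 0 \<in> sem w (\<lambda>_. {}) \<phi>"

primrec modalities :: "'a form \<Rightarrow> modality set" where
  "modalities (Var x) = {}"
| "modalities (Atom A) = {}"
| "modalities (NegAtom A) = {}"
| "modalities (Mod m \<phi>) = insert m (modalities \<phi>)"
| "modalities (Or \<phi> \<psi>) = modalities \<phi> \<union> modalities \<psi>"
| "modalities (And \<phi> \<psi>) = modalities \<phi> \<union> modalities \<psi>"
| "modalities (Mu x \<phi>) = modalities \<phi>"
| "modalities (Nu x \<phi>) = modalities \<phi>"

text \<open>The set function of the datatype collects the letters occurring in a formula.\<close>

definition Formulas :: "'a set \<Rightarrow> modality set \<Rightarrow> 'a form set" where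
  "Formulas \<Sigma> M = {\<phi>. set_form \<phi> \<subseteq> \<Sigma> \<and> modalities \<phi> \<subseteq> M}"

text \<open>Simultaneous capture-avoiding substitution: in the body of a fixpoint, \<open>bound_name \<sigma> x \<phi>\<close>
  replaces the bound variable \<open>x\<close>; it differs from \<open>x\<close> only if \<open>x\<close> would capture a free variable
  of a substituted formula.\<close>

definition bound_name :: "(nat \<Rightarrow> 'a form) \<Rightarrow> nat \<Rightarrow> 'a form \<Rightarrow> nat" where
  "bound_name \<sigma> x \<phi> =
     (let F = (\<Union>z \<in> free_vars \<phi> - {x}. free_vars (\<sigma> z))
      in if x \<notin> F then x else (LEAST y. y \<notin> F))"

primrec subst :: "(nat \<Rightarrow> 'a form) \<Rightarrow> 'a form \<Rightarrow> 'a form" where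
  "subst \<sigma> (Var x) = \<sigma> x"
| "subst \<sigma> (Atom A) = Atom A"
| "subst \<sigma> (NegAtom A) = NegAtom A"
| "subst \<sigma> (Mod m \<phi>) = Mod m (subst \<sigma> \<phi>)"
| "subst \<sigma> (Or \<phi> \<psi>) = Or (subst \<sigma> \<phi>) (subst \<sigma> \<psi>)"
| "subst \<sigma> (And \<phi> \<psi>) = And (subst \<sigma> \<phi>) (subst \<sigma> \<psi>)"
| "subst \<sigma> (Mu x \<phi>) =
     Mu (bound_name \<sigma> x \<phi>) (subst (\<sigma>(x := Var (bound_name \<sigma> x \<phi>))) \<phi>)"
| "subst \<sigma> (Nu x \<phi>) =
     Nu (bound_name \<sigma> x \<phi>) (subst (\<sigma>(x := Var (bound_name \<sigma> x \<phi>))) \<phi>)"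

text \<open>In \<open>\<psi>(x\<^sub>1, \<dots>, x\<^sub>n)\<close> the variables \<open>x\<^sub>1, \<dots>, x\<^sub>n\<close> are the free variables of \<open>\<psi>\<close>. All of them
  are replaced, so \<open>Comp_level 1 \<Psi>\<close> consists of the sentences in \<open>\<Psi>\<close>, up to the choice made
  by \<open>subst\<close> for bound names.\<close>

primrec Comp_level :: "nat \<Rightarrow> 'a form set \<Rightarrow> 'a form set" where
  "Comp_level 0 \<Psi> = {}"
| "Comp_level (Suc i) \<Psi> =
     {subst \<sigma> \<psi> | \<sigma> \<psi>. \<psi> \<in> \<Psi> \<and> (\<forall>x \<in> free_vars \<psi>. \<sigma> x \<in> Comp_level i \<Psi>)}"

definition Comp :: "'a form set \<Rightarrow> 'a form set" where
  "Comp \<Psi> = (\<Union>i. Comp_level i \<Psi>)"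

definition BR :: "'a set \<Rightarrow> 'a form set" where
  "BR \<Sigma> = Comp (Formulas \<Sigma> {Xc, Xg} \<union> Formulas \<Sigma> {Yc, Yg})"


section \<open>Class-memory transducers and cascades\<close>

text \<open>A marking is a pair \<open>(p, s)\<close>; \<open>True\<close> stands for the unnegated symbol.\<close>

type_synonym marking = "bool \<times> bool"

definition tp :: "('a, 'd) data_word \<Rightarrow> nat \<Rightarrow> marking" where
  "tp w i = (pred_in_class w i, succ_in_class w i)"

datatype 'q memory = Top | Bot | State 'q

text \<open>State sets and alphabets are finite sets inside the universes \<open>'q\<close> and \<open>'a\<close>, so that
  transducers with different state sets and alphabets have the same type and can be composed.\<close>

record ('a, 'q) cmt =
  states :: "'q set"
  in_alphabet :: "'a set"
  out_alphabet :: "'a set"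
  delta :: "'q \<Rightarrow> 'q memory \<Rightarrow> 'a \<Rightarrow> marking \<Rightarrow> 'q \<times> 'a"
  init :: 'q
  class_final :: "'q set"
  global_final :: "'q set"

definition is_cmt :: "('a, 'q) cmt \<Rightarrow> bool" where
  "is_cmt A \<longleftrightarrow>
     finite (states A) \<and> finite (in_alphabet A) \<and> finite (out_alphabet A) \<and>
     init A \<in> states A \<and> class_final A \<subseteq> states A \<and> global_final A \<subseteq> states A \<and>
     (\<forall>q \<in> states A. \<forall>m \<in> {Top, Bot} \<union> State ` states A. \<forall>a \<in> in_alphabet A. \<forall>t.
        delta A q m a t \<in> states A \<times> out_alphabet A)"

datatype direction = Forward | Backward

text \<open>\<open>run d A w qs w'\<close>: \<open>qs = [q\<^sub>0, \<dots>, q\<^sub>n]\<close> is a run of \<open>A\<close> on \<open>w\<close> in direction \<open>d\<close>, with output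
  data word \<open>w'\<close>. The state after the 0-based position \<open>i\<close> is \<open>qs ! (i + 1)\<close> for forward and
  \<open>qs ! (n - i)\<close> for backward transducers.\<close>

fun run :: "direction \<Rightarrow> ('a, 'q) cmt \<Rightarrow> ('a, 'd) data_word \<Rightarrow> 'q list \<Rightarrow> ('a, 'd) data_word \<Rightarrow> bool"
where
  "run Forward A w qs w' \<longleftrightarrow>
     length qs = length w + 1 \<and> map snd w' = map snd w \<and> qs ! 0 = init A \<and>
     (\<forall>i < length w.
        delta A (qs ! i)
          (case class_pred w i of None \<Rightarrow> Bot | Some j \<Rightarrow> State (qs ! (j + 1)))
          (fst (w ! i)) (tp w i)
        = (qs ! (i + 1), fst (w' ! i)))"
| "run Backward A w qs w' \<longleftrightarrow>
     length qs = length w + 1 \<and> map snd w' = map snd w \<and> qs ! 0 = init A \<and>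
     (\<forall>i < length w.
        delta A (qs ! (length w - i - 1))
          (case class_succ w i of None \<Rightarrow> Top | Some j \<Rightarrow> State (qs ! (length w - j)))
          (fst (w ! i)) (tp w i)
        = (qs ! (length w - i), fst (w' ! i)))"

fun successful :: "direction \<Rightarrow> ('a, 'q) cmt \<Rightarrow> ('a, 'd) data_word \<Rightarrow> 'q list \<Rightarrow> bool" where
  "successful Forward A w qs \<longleftrightarrow>
     qs ! length w \<in> global_final A \<and>
     (\<forall>i < length w. class_succ w i = None \<longrightarrow> qs ! (i + 1) \<in> class_final A)"
| "successful Backward A w qs \<longleftrightarrow>
     qs ! length w \<in> global_final A \<and>
     (\<forall>i < length w. class_pred w i = None \<longrightarrow> qs ! (length w - i) \<in> class_final A)"

type_synonym ('a, 'q) cascade = "(direction \<times> ('a, 'q) cmt) list"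

text \<open>\<open>is_cascade \<Sigma>\<^sub>0 C\<close>: \<open>C\<close> lists the transducers of a cascade whose first alphabet is \<open>\<Sigma>\<^sub>0\<close>; the
  remaining alphabets are the output alphabets of the transducers, and the height is the length.\<close>

fun is_cascade :: "'a set \<Rightarrow> ('a, 'q) cascade \<Rightarrow> bool" where
  "is_cascade \<Sigma> [] \<longleftrightarrow> finite \<Sigma>"
| "is_cascade \<Sigma> ((d, A) # C) \<longleftrightarrow> is_cmt A \<and> in_alphabet A = \<Sigma> \<and> is_cascade (out_alphabet A) C"

definition cascades :: "'a set \<Rightarrow> ('a, 'q) cascade set" where
  "cascades \<Sigma> = {C. is_cascade \<Sigma> C}"

fun accepts :: "('a, 'q) cascade \<Rightarrow> ('a, 'd) data_word \<Rightarrow> bool" where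
  "accepts [] w \<longleftrightarrow> True"
| "accepts ((d, A) # C) w \<longleftrightarrow>
     (\<exists>qs w'. run d A w qs w' \<and> successful d A w qs \<and> accepts C w')"

end

theory Submission
  imports Defs "HOL-Library.Nat_Bijection"
begin

text \<open>From formulas to cascades: a formula with modalities for one direction is evaluated by a
  transducer of the opposite reading direction whose state is the tree of truth values of the
  subformulas at the current position. Fixpoints are resolved locally: for monotone \<open>F\<close>, a point \<open>i\<close> is in
  \<open>lfp F\<close> iff it is in \<open>F (lfp F - {i})\<close>, and values at modal targets do not depend on \<open>i\<close>. Compositions of
  formulas become concatenations of such transducers, each adding its result to the letters.

  From cascades to formulas: that a transducer is in state \<open>q\<close> at a position is a mutual recursion over the
  modalities of its direction, whose solution is unique because every modality moves to positions read
  earlier. Nesting least fixpoints turns it into a formula whose free variables stand for the input letters;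
  composition substitutes the formulas for the output letters of the preceding transducer. Success is
  checked by a composition with a formula saying ``at all positions''.\<close>

section \<open>Positions and modalities\<close>

text \<open>Both translations rest on one fact: a modality in \<open>dir_mods d\<close> leads to a
  position of smaller \<open>rank\<close>, and its targets are exactly the positions whose states a
  transducer of direction \<open>d\<close> sees, through the previous state and through the memory.
  A state must hold a whole tree because a modal subformula asks for the value of its argument at
  the target, and a variable occurring there asks for its fixpoint. If every variable were guarded
  by a modality, fixpoints would be unique; a formula such as \<open>Mu x (Var x)\<close> is not
  guarded, and this is why the value at the position itself has to start from false (true for
  \<open>Nu\<close>). The elimination of mutual recursion is Bekic's principle, in the easy case of
  unique solutions. All transducers of a cascade share one type of letters and one type of states,
  so the pairs and trees of the construction are coded by natural numbers and injected into these
  infinite types.\<close>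

fun opp :: "direction \<Rightarrow> direction" where
  "opp Forward = Backward"
| "opp Backward = Forward"

fun step_mod :: "direction \<Rightarrow> modality" where
  "step_mod Forward = Yg"
| "step_mod Backward = Xg"

fun class_mod :: "direction \<Rightarrow> modality" where
  "class_mod Forward = Yc"
| "class_mod Backward = Xc"

abbreviation dir_mods :: "direction \<Rightarrow> modality set" where
  "dir_mods d \<equiv> {step_mod d, class_mod d}"

text \<open>The number of positions that a transducer of direction \<open>d\<close> processes before position \<open>i\<close>.\<close>

fun rank :: "direction \<Rightarrow> nat \<Rightarrow> nat \<Rightarrow> nat" where
  "rank Forward n i = i"
| "rank Backward n i = n - 1 - i"

lemma class_succ_SomeD:
  assumes "class_succ w i = Some j"
  shows "i < j \<and> j < length w \<and> same_class w i j"
proof -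
  have ex: "\<exists>j. i < j \<and> j < length w \<and> same_class w i j"
    using assms by (auto simp: class_succ_def split: if_splits)
  then have "j = (LEAST j. i < j \<and> j < length w \<and> same_class w i j)"
    using assms by (auto simp: class_succ_def split: if_splits)
  then show ?thesis using LeastI_ex[OF ex] by simp
qed

lemma class_pred_SomeD:
  assumes "class_pred w i = Some j"
  shows "j < i \<and> same_class w i j"
proof -
  have ex: "\<exists>j. j < i \<and> same_class w i j"
    using assms by (auto simp: class_pred_def split: if_splits)
  then have "j = (GREATEST j. j < i \<and> same_class w i j)"
    using assms by (auto simp: class_pred_def split: if_splits)
  then show ?thesis
    using GreatestI_ex_nat[of "\<lambda>j. j < i \<and> same_class w i j" i] ex by (metis less_imp_le)
qed

lemma target_less_length: "i < length w \<Longrightarrow> target w m i = Some j \<Longrightarrow> j < length w"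
  by (cases m) (auto split: if_splits dest: class_succ_SomeD class_pred_SomeD)

lemma target_rank_less:
  assumes "i < length w" "m \<in> dir_mods d" "target w m i = Some j"
  shows "rank d (length w) j < rank d (length w) i"
  using assms
  by (cases d) (auto split: if_splits dest!: class_succ_SomeD class_pred_SomeD)

lemma rank_closed:
  assumes "m \<in> dir_mods d" "i < length w" "rank d (length w) i < r" "target w m i = Some j"
  shows "rank d (length w) j < r"
  using target_rank_less[OF assms(2,1,4)] assms(3) by simp


section \<open>Semantics of formulas\<close>

lemma sem_less_length: "i \<in> sem w V \<phi> \<Longrightarrow> i < length w"
proof (induction \<phi> arbitrary: V i)
  case (Mu x \<phi>)
  have "sem w V (Mu x \<phi>) \<subseteq> {..<length w}"
    unfolding sem.simps by (rule lfp_lowerbound) (use Mu.IH in auto)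
  then show ?case using Mu.prems by auto
next
  case (Nu x \<phi>)
  have "sem w V (Nu x \<phi>) \<subseteq> {..<length w}"
    unfolding sem.simps by (rule gfp_least) (use Nu.IH in blast)
  then show ?case using Nu.prems by auto
qed auto

lemma sem_mono: "(\<And>x. V x \<subseteq> V' x) \<Longrightarrow> sem w V \<phi> \<subseteq> sem w V' \<phi>"
proof (induction \<phi> arbitrary: V V')
  case (Mod m \<phi>)
  then show ?case using Mod.IH[OF Mod.prems] by auto
next
  case (Or \<phi> \<psi>)
  show ?case unfolding sem.simps by (intro Un_mono Or.IH Or.prems)
next
  case (And \<phi> \<psi>)
  show ?case unfolding sem.simps by (intro Int_mono And.IH And.prems)
next
  case (Mu x \<phi>)
  show ?case unfolding sem.simps by (rule lfp_mono, rule Mu.IH) (use Mu.prems in auto)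
next
  case (Nu x \<phi>)
  show ?case unfolding sem.simps by (rule gfp_mono, rule Nu.IH) (use Nu.prems in auto)
qed auto

lemma mono_sem_upd: "mono (\<lambda>X. sem w (V(x := X)) \<phi>)"
  by (rule monoI, rule sem_mono) auto

text \<open>Evaluation started in \<open>D\<close> never leaves \<open>D\<close>, so the valuation
  outside \<open>D\<close> has no influence. Only an inclusion of valuations is assumed: this form
  suits both kinds of fixpoint, and \<open>sem_local\<close> applies it in both directions.\<close>

lemma sem_local_imp:
  assumes "\<And>m i j. m \<in> modalities \<phi> \<Longrightarrow> i \<in> D \<Longrightarrow> i < length w \<Longrightarrow> target w m i = Some j \<Longrightarrow> j \<in> D"
    and "\<And>x i. x \<in> free_vars \<phi> \<Longrightarrow> i \<in> D \<Longrightarrow> i < length w \<Longrightarrow> i \<in> V x \<Longrightarrow> i \<in> V' x"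
    and "i \<in> D" "i \<in> sem w V \<phi>"
  shows "i \<in> sem w V' \<phi>"
  using assms
proof (induction \<phi> arbitrary: V V' i)
  case (Mod m \<phi>)
  from Mod.prems(4) obtain j where j: "i < length w" "target w m i = Some j" "j \<in> sem w V \<phi>"
    by auto
  have "j \<in> D" using Mod.prems(1)[of m i j] Mod.prems(3) j by simp
  have "j \<in> sem w V' \<phi>"
    by (rule Mod.IH[of V V' j]) (use Mod.prems \<open>j \<in> D\<close> j in auto)
  then show ?case using j by auto
next
  case (Or \<phi> \<psi>)
  show ?case
  proof (cases "i \<in> sem w V \<phi>")
    case True
    have "i \<in> sem w V' \<phi>" by (rule Or.IH(1)[of V V' i]) (use Or.prems True in auto)
    then show ?thesis by simp
  next
    case False
    have "i \<in> sem w V' \<psi>" by (rule Or.IH(2)[of V V' i]) (use Or.prems False in auto)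
    then show ?thesis by simp
  qed
next
  case (And \<phi> \<psi>)
  have "i \<in> sem w V' \<phi>" by (rule And.IH(1)[of V V' i]) (use And.prems in auto)
  moreover have "i \<in> sem w V' \<psi>" by (rule And.IH(2)[of V V' i]) (use And.prems in auto)
  ultimately show ?case by simp
next
  case (Mu x \<phi>)
  let ?L = "lfp (\<lambda>X. sem w (V'(x := X)) \<phi>)"
  \<comment> \<open>Outside \<open>D\<close> nothing is known about the fixpoint for
    \<open>V\<close>, so the candidate takes in the whole complement. On \<open>D\<close> it
    coincides with the fixpoint for \<open>V'\<close>, which makes it a prefixed point for
    \<open>V\<close>.\<close>
  let ?Z = "?L \<union> - D"
  have "sem w (V(x := ?Z)) \<phi> \<subseteq> ?Z"
  proof
    fix k assume k: "k \<in> sem w (V(x := ?Z)) \<phi>"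
    show "k \<in> ?Z"
    proof (cases "k \<in> D")
      case True
      have "k \<in> sem w (V'(x := ?L)) \<phi>"
        by (rule Mu.IH[OF _ _ True k]) (use Mu.prems True in auto)
      then show ?thesis using lfp_unfold[OF mono_sem_upd, of w V' x \<phi>] by auto
    qed auto
  qed
  then have "lfp (\<lambda>X. sem w (V(x := X)) \<phi>) \<subseteq> ?Z" by (rule lfp_lowerbound)
  then show ?case using Mu.prems by auto
next
  case (Nu x \<phi>)
  let ?G = "gfp (\<lambda>X. sem w (V(x := X)) \<phi>)"
  \<comment> \<open>Dually, cutting the greatest fixpoint for \<open>V\<close> down to
    \<open>D\<close> leaves a postfixed point for \<open>V'\<close>.\<close>
  have "?G \<inter> D \<subseteq> sem w (V'(x := ?G \<inter> D)) \<phi>"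
  proof
    fix k assume k: "k \<in> ?G \<inter> D"
    then have kD: "k \<in> D" and kG: "k \<in> sem w (V(x := ?G)) \<phi>"
      using gfp_unfold[OF mono_sem_upd, of w V x \<phi>] by auto
    show "k \<in> sem w (V'(x := ?G \<inter> D)) \<phi>"
      by (rule Nu.IH[OF _ _ kD kG]) (use Nu.prems in auto)
  qed
  then have "?G \<inter> D \<subseteq> gfp (\<lambda>X. sem w (V'(x := X)) \<phi>)" by (rule gfp_upperbound)
  then show ?case using Nu.prems by auto
qed auto

lemma sem_local:
  assumes "\<And>m i j. m \<in> modalities \<phi> \<Longrightarrow> i \<in> D \<Longrightarrow> i < length w \<Longrightarrow> target w m i = Some j \<Longrightarrow> j \<in> D"
    and "\<And>x i. x \<in> free_vars \<phi> \<Longrightarrow> i \<in> D \<Longrightarrow> i < length w \<Longrightarrow> i \<in> V x \<longleftrightarrow> i \<in> V' x"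
    and "i \<in> D"
  shows "i \<in> sem w V \<phi> \<longleftrightarrow> i \<in> sem w V' \<phi>"
  using sem_local_imp[of \<phi> D w V V' i] sem_local_imp[of \<phi> D w V' V i] assms by blast

lemma sem_cong:
  assumes "\<And>x i. x \<in> free_vars \<phi> \<Longrightarrow> i < length w \<Longrightarrow> i \<in> V x \<longleftrightarrow> i \<in> V' x"
  shows "sem w V \<phi> = sem w V' \<phi>"
  using sem_local[of \<phi> UNIV w V V'] assms by auto

lemma sem_closed: "free_vars \<phi> = {} \<Longrightarrow> sem w V \<phi> = sem w V' \<phi>"
  by (rule sem_cong) auto

lemma finite_free_vars: "finite (free_vars \<phi>)"
  by (induction \<phi>) auto


section \<open>Closed substitutions and composition\<close>

text \<open>Members of a composition class are sentences, so the substitutions that form them never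
  capture a variable.\<close>

definition closed_subst :: "(nat \<Rightarrow> 'a form) \<Rightarrow> 'a form \<Rightarrow> bool" where
  "closed_subst \<sigma> \<phi> \<longleftrightarrow> (\<forall>z \<in> free_vars \<phi>. \<sigma> z = Var z \<or> free_vars (\<sigma> z) = {})"

lemma bound_name_closed:
  assumes "\<forall>z \<in> free_vars \<phi> - {x}. \<sigma> z = Var z \<or> free_vars (\<sigma> z) = {}"
  shows "bound_name \<sigma> x \<phi> = x"
proof -
  have "x \<notin> free_vars (\<sigma> z)" if "z \<in> free_vars \<phi> - {x}" for z
  proof -
    have "\<sigma> z = Var z \<or> free_vars (\<sigma> z) = {}" using assms that by blast
    then show ?thesis using that by auto
  qed
  then have "x \<notin> (\<Union>z \<in> free_vars \<phi> - {x}. free_vars (\<sigma> z))" by blast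
  then show ?thesis by (simp add: bound_name_def Let_def)
qed

lemma free_vars_subst:
  "closed_subst \<sigma> \<phi> \<Longrightarrow> free_vars (subst \<sigma> \<phi>) \<subseteq> {z \<in> free_vars \<phi>. \<sigma> z = Var z}"
proof (induction \<phi> arbitrary: \<sigma>)
  case (Mu x \<phi>)
  have bn: "bound_name \<sigma> x \<phi> = x" using Mu.prems by (auto simp: closed_subst_def intro: bound_name_closed)
  have "closed_subst (\<sigma>(x := Var x)) \<phi>" using Mu.prems by (auto simp: closed_subst_def)
  then have "free_vars (subst (\<sigma>(x := Var x)) \<phi>) \<subseteq> {z \<in> free_vars \<phi>. (\<sigma>(x := Var x)) z = Var z}"
    by (rule Mu.IH)
  also have "\<dots> \<subseteq> insert x {z \<in> free_vars \<phi> - {x}. \<sigma> z = Var z}" by auto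
  finally show ?case unfolding subst.simps free_vars.simps bn by blast
next
  case (Nu x \<phi>)
  have bn: "bound_name \<sigma> x \<phi> = x" using Nu.prems by (auto simp: closed_subst_def intro: bound_name_closed)
  have "closed_subst (\<sigma>(x := Var x)) \<phi>" using Nu.prems by (auto simp: closed_subst_def)
  then have "free_vars (subst (\<sigma>(x := Var x)) \<phi>) \<subseteq> {z \<in> free_vars \<phi>. (\<sigma>(x := Var x)) z = Var z}"
    by (rule Nu.IH)
  also have "\<dots> \<subseteq> insert x {z \<in> free_vars \<phi> - {x}. \<sigma> z = Var z}" by auto
  finally show ?case unfolding subst.simps free_vars.simps bn by blast
next
  case (Or \<phi> \<psi>)
  then have "closed_subst \<sigma> \<phi>" "closed_subst \<sigma> \<psi>" by (auto simp: closed_subst_def)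
  then show ?case using Or.IH by fastforce
next
  case (And \<phi> \<psi>)
  then have "closed_subst \<sigma> \<phi>" "closed_subst \<sigma> \<psi>" by (auto simp: closed_subst_def)
  then show ?case using And.IH by fastforce
qed (auto simp: closed_subst_def)

text \<open>The value of a substituted sentence is unaffected by the update of a bound variable. The
  case \<open>\<sigma> z = Var z\<close> of \<open>closed_subst\<close> serves the recursion below a
  binder, where the bound variable is mapped to itself.\<close>

lemma sem_subst:
  "closed_subst \<sigma> \<phi> \<Longrightarrow> sem w V (subst \<sigma> \<phi>) = sem w (\<lambda>z. sem w V (\<sigma> z)) \<phi>"
proof (induction \<phi> arbitrary: \<sigma> V)
  case (Var x)
  then show ?case using sem_less_length by fastforce
next
  case (Mu x \<phi>)
  have bn: "bound_name \<sigma> x \<phi> = x" using Mu.prems by (auto simp: closed_subst_def intro: bound_name_closed)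
  have cl: "closed_subst (\<sigma>(x := Var x)) \<phi>" using Mu.prems by (auto simp: closed_subst_def)
  have eq: "sem w (V(x := X)) (subst (\<sigma>(x := Var x)) \<phi>)
    = sem w ((\<lambda>z. sem w V (\<sigma> z))(x := X)) \<phi>" for X
    unfolding Mu.IH[OF cl]
  proof (rule sem_cong)
    fix z i assume "z \<in> free_vars \<phi>" "i < length w"
    then show "i \<in> sem w (V(x := X)) ((\<sigma>(x := Var x)) z) \<longleftrightarrow> i \<in> ((\<lambda>z. sem w V (\<sigma> z))(x := X)) z"
      using Mu.prems sem_closed[of "\<sigma> z" w V "V(x := X)"]
      by (cases "z = x"; cases "\<sigma> z = Var z") (auto simp: closed_subst_def)
  qed
  show ?case by (simp add: bn eq)
next
  case (Nu x \<phi>)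
  have bn: "bound_name \<sigma> x \<phi> = x" using Nu.prems by (auto simp: closed_subst_def intro: bound_name_closed)
  have cl: "closed_subst (\<sigma>(x := Var x)) \<phi>" using Nu.prems by (auto simp: closed_subst_def)
  have eq: "sem w (V(x := X)) (subst (\<sigma>(x := Var x)) \<phi>)
    = sem w ((\<lambda>z. sem w V (\<sigma> z))(x := X)) \<phi>" for X
    unfolding Nu.IH[OF cl]
  proof (rule sem_cong)
    fix z i assume "z \<in> free_vars \<phi>" "i < length w"
    then show "i \<in> sem w (V(x := X)) ((\<sigma>(x := Var x)) z) \<longleftrightarrow> i \<in> ((\<lambda>z. sem w V (\<sigma> z))(x := X)) z"
      using Nu.prems sem_closed[of "\<sigma> z" w V "V(x := X)"]
      by (cases "z = x"; cases "\<sigma> z = Var z") (auto simp: closed_subst_def)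
  qed
  show ?case by (simp add: bn eq)
qed (auto simp: closed_subst_def)

lemma Comp_level_sentence: "\<phi> \<in> Comp_level l \<Psi> \<Longrightarrow> free_vars \<phi> = {}"
proof (induction l arbitrary: \<phi>)
  case (Suc l)
  then obtain \<sigma> \<psi> where \<psi>: "\<phi> = subst \<sigma> \<psi>" "\<forall>x \<in> free_vars \<psi>. \<sigma> x \<in> Comp_level l \<Psi>" by auto
  then have cl: "\<forall>x \<in> free_vars \<psi>. free_vars (\<sigma> x) = {}" using Suc.IH by blast
  then have "free_vars \<phi> \<subseteq> {z \<in> free_vars \<psi>. \<sigma> z = Var z}"
    using free_vars_subst[of \<sigma> \<psi>] \<psi>(1) by (auto simp: closed_subst_def)
  then show ?case using cl by fastforce
qed simp

lemma sem_subst_Comp: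
  assumes "\<forall>x \<in> free_vars \<psi>. \<sigma> x \<in> Comp_level l \<Psi>"
  shows "sem w V (subst \<sigma> \<psi>) = sem w (\<lambda>z. sem w V (\<sigma> z)) \<psi>"
  by (rule sem_subst) (use assms Comp_level_sentence in \<open>unfold closed_subst_def, blast\<close>)

lemma Comp_level_Suc_mono: "Comp_level l \<Psi> \<subseteq> Comp_level (Suc l) \<Psi>"
  by (induction l) (simp, fastforce)

lemma Comp_level_mono: "l \<le> l' \<Longrightarrow> Comp_level l \<Psi> \<subseteq> Comp_level l' \<Psi>"
  using lift_Suc_mono_le[of "\<lambda>l. Comp_level l \<Psi>"] Comp_level_Suc_mono by blast

lemma Comp_level_SucI:
  "\<psi> \<in> \<Psi> \<Longrightarrow> (\<And>x. x \<in> free_vars \<psi> \<Longrightarrow> \<sigma> x \<in> Comp_level l \<Psi>) \<Longrightarrow> subst \<sigma> \<psi> \<in> Comp_level (Suc l) \<Psi>"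
  by auto

abbreviation BR_base :: "'a set \<Rightarrow> 'a form set" where
  "BR_base \<Sigma> \<equiv> Formulas \<Sigma> {Xc, Xg} \<union> Formulas \<Sigma> {Yc, Yg}"

lemma Formulas_dir_BR_base: "Formulas \<Sigma> (dir_mods d) \<subseteq> BR_base \<Sigma>"
  by (cases d) (auto simp: insert_commute)


section \<open>Runs as state labellings of positions\<close>

text \<open>Transducers keep the data values, so every word in a cascade is a relabelling of the
  input word, with the same targets and types. This lets the input word stay fixed while only the
  labels change.\<close>

definition relab :: "('a, 'd) data_word \<Rightarrow> (nat \<Rightarrow> 'b) \<Rightarrow> ('b, 'd) data_word" where
  "relab w f = map (\<lambda>i. (f i, snd (w ! i))) [0..<length w]"

lemma length_relab [simp]: "length (relab w f) = length w"
  by (simp add: relab_def)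

lemma nth_relab [simp]: "i < length w \<Longrightarrow> relab w f ! i = (f i, snd (w ! i))"
  by (simp add: relab_def)

lemma map_snd_relab [simp]: "map snd (relab w f) = map snd w"
  by (rule nth_equalityI) auto

lemma relab_relab [simp]: "relab (relab w f) g = relab w g"
  by (rule nth_equalityI) auto

lemma relab_Nil_iff [simp]: "relab w f = [] \<longleftrightarrow> w = []"
  by (simp add: relab_def)

lemma relab_id: "relab w (\<lambda>i. fst (w ! i)) = w"
  by (rule nth_equalityI) auto

lemma relabI:
  assumes "map snd w' = map snd w" "\<And>i. i < length w \<Longrightarrow> fst (w' ! i) = f i"
  shows "w' = relab w f"
proof (rule nth_equalityI)
  show len: "length w' = length (relab w f)" using assms(1) by (metis length_map length_relab)
  fix i assume i: "i < length w'"
  then have "snd (w' ! i) = snd (w ! i)" using assms(1) len by (metis length_relab nth_map)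
  then show "w' ! i = relab w f ! i" using assms(2)[of i] i len by (simp add: prod_eq_iff)
qed

lemma target_relab [simp]:
  assumes "i < length w"
  shows "target (relab w f) m i = target w m i"
proof -
  have "class_succ (relab w f) i = class_succ w i"
  proof -
    have "(\<lambda>j. i < j \<and> j < length w \<and> same_class (relab w f) i j)
        = (\<lambda>j. i < j \<and> j < length w \<and> same_class w i j)"
      using assms by (auto simp: same_class_def)
    then show ?thesis unfolding class_succ_def length_relab by metis
  qed
  moreover have "class_pred (relab w f) i = class_pred w i"
  proof -
    have "(\<lambda>j. j < i \<and> same_class (relab w f) i j) = (\<lambda>j. j < i \<and> same_class w i j)"
      using assms by (auto simp: same_class_def)
    then show ?thesis unfolding class_pred_def by metis
  qed
  ultimately show ?thesis by (cases m) auto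
qed

lemma tp_relab [simp]: "i < length w \<Longrightarrow> tp (relab w f) i = tp w i"
  using target_relab[of i w f Xc] target_relab[of i w f Yc]
  by (simp add: tp_def pred_in_class_def succ_in_class_def)

fun empty_memory :: "direction \<Rightarrow> 'q memory" where
  "empty_memory Forward = Bot"
| "empty_memory Backward = Top"

text \<open>Indexing states by positions instead of by time merges the two clauses of
  \<open>run\<close>: in either direction the previous state is the one at the target of
  \<open>step_mod d\<close>.\<close>

definition trans :: "direction \<Rightarrow> ('a, 'q) cmt \<Rightarrow> ('a, 'd) data_word \<Rightarrow> (nat \<Rightarrow> 'q) \<Rightarrow> nat \<Rightarrow> 'q \<times> 'a" where
  "trans d A w s i =
     delta A (case target w (step_mod d) i of None \<Rightarrow> init A | Some j \<Rightarrow> s j)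
       (case target w (class_mod d) i of None \<Rightarrow> empty_memory d | Some j \<Rightarrow> State (s j))
       (fst (w ! i)) (tp w i)"

text \<open>The final position of a run is the one without a successor in the processing order.\<close>

definition success :: "direction \<Rightarrow> ('a, 'q) cmt \<Rightarrow> ('a, 'd) data_word \<Rightarrow> (nat \<Rightarrow> 'q) \<Rightarrow> bool" where
  "success d A w s \<longleftrightarrow> (\<forall>i < length w.
     (target w (step_mod (opp d)) i = None \<longrightarrow> s i \<in> global_final A) \<and>
     (target w (class_mod (opp d)) i = None \<longrightarrow> s i \<in> class_final A))"

fun state_index :: "direction \<Rightarrow> nat \<Rightarrow> nat \<Rightarrow> nat" where
  "state_index Forward n i = i + 1"
| "state_index Backward n i = n - i"

lemma run_iff_trans:
  "run d A w qs w' \<longleftrightarrow> length qs = length w + 1 \<and> map snd w' = map snd w \<and> qs ! 0 = init A \<and>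
     (\<forall>i < length w. trans d A w (\<lambda>i. qs ! state_index d (length w) i) i
        = (qs ! state_index d (length w) i, fst (w' ! i)))"
proof (cases d)
  case Forward
  have "trans d A w (\<lambda>i. qs ! state_index d (length w) i) i = delta A (qs ! i)
      (case class_pred w i of None \<Rightarrow> Bot | Some j \<Rightarrow> State (qs ! (j + 1))) (fst (w ! i)) (tp w i)"
    if "qs ! 0 = init A" for i
    using that unfolding trans_def Forward by (cases i) (simp_all cong: option.case_cong)
  then show ?thesis unfolding Forward run.simps state_index.simps by metis
next
  case Backward
  have "trans d A w (\<lambda>i. qs ! state_index d (length w) i) i = delta A (qs ! (length w - i - 1))
      (case class_succ w i of None \<Rightarrow> Top | Some j \<Rightarrow> State (qs ! (length w - j))) (fst (w ! i)) (tp w i)"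
    if "qs ! 0 = init A" "i < length w" for i
  proof (cases "i + 1 < length w")
    case False
    \<comment> \<open>The last position is read first, so its previous state is entry 0 of the list,
      the initial state.\<close>
    then have "length w - i - 1 = 0" using that by simp
    then show ?thesis using that False unfolding trans_def Backward by (simp cong: option.case_cong)
  qed (simp add: trans_def Backward cong: option.case_cong)
  then show ?thesis unfolding Backward run.simps state_index.simps by metis
qed

lemma last_target_iff:
  assumes "i < length w"
  shows "target w (step_mod (opp d)) i = None \<longleftrightarrow> state_index d (length w) i = length w"
  using assms by (cases d) auto

lemma ex_last_index: "w \<noteq> [] \<Longrightarrow> \<exists>i < length w. state_index d (length w) i = length w"
  by (cases d) (auto intro: exI[of _ "length w - 1"] exI[of _ 0])

text \<open>\<open>success\<close> attaches the condition on the last state to a position of the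
  word; a nonempty word supplies that position.\<close>

lemma successful_iff_success:
  assumes "w \<noteq> []"
  shows "successful d A w qs \<longleftrightarrow> success d A w (\<lambda>i. qs ! state_index d (length w) i)"
proof -
  have "successful d A w qs \<longleftrightarrow> qs ! length w \<in> global_final A \<and>
    (\<forall>i < length w. target w (class_mod (opp d)) i = None \<longrightarrow> qs ! state_index d (length w) i \<in> class_final A)"
    by (cases d) simp_all
  also have "qs ! length w \<in> global_final A \<longleftrightarrow>
    (\<forall>i < length w. state_index d (length w) i = length w \<longrightarrow> qs ! state_index d (length w) i \<in> global_final A)"
    using ex_last_index[OF assms, of d] by auto
  finally show ?thesis unfolding success_def using last_target_iff[of _ w d] by blast
qed

lemma trans_cong:
  assumes "i < length w" "\<And>j. j < length w \<Longrightarrow> rank d (length w) j < rank d (length w) i \<Longrightarrow> s j = s' j"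
  shows "trans d A w s i = trans d A w s' i"
proof -
  have "s j = s' j" if "m \<in> dir_mods d" "target w m i = Some j" for m j
    using assms target_rank_less[OF assms(1) that] target_less_length[OF assms(1) that(2)] by blast
  from this[of "step_mod d"] this[of "class_mod d"] show ?thesis
    unfolding trans_def by (simp split: option.splits)
qed

lemma trans_unique:
  assumes "\<And>i. i < length w \<Longrightarrow> s i = fst (trans d A w s i)"
    and "\<And>i. i < length w \<Longrightarrow> s' i = fst (trans d A w s' i)"
  shows "i < length w \<Longrightarrow> s i = s' i"
proof (induction "rank d (length w) i" arbitrary: i rule: less_induct)
  case less
  then have "trans d A w s i = trans d A w s' i" by (intro trans_cong) auto
  then show ?case using assms less.prems by metis
qed

text \<open>\<open>delta\<close> is total, so well-founded recursion along \<open>rank\<close>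
  yields a labelling on every word, with no condition on its letters.\<close>

lemma trans_exists:
  fixes A :: "('a, 'b) cmt"
  shows "\<exists>s. \<forall>i < length w. s i = fst (trans d A w s i)"
proof -
  let ?R = "measure (rank d (length w))"
  have "\<exists>s. \<forall>i. i < length w \<longrightarrow> s i = fst (trans d A w s i)"
  proof (rule dependent_wf_choice[where R = ?R and P = "\<lambda>s i r. i < length w \<longrightarrow> r = fst (trans d A w s i)"])
    show "wf ?R" by simp
    fix f g :: "nat \<Rightarrow> 'b" and x :: nat and r :: 'b
    assume "\<And>z. (z, x) \<in> ?R \<Longrightarrow> f z = g z"
    then show "(x < length w \<longrightarrow> r = fst (trans d A w f x)) = (x < length w \<longrightarrow> r = fst (trans d A w g x))"
      using trans_cong[of x w d f g A] by auto
  qed auto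
  then show ?thesis by auto
qed

text \<open>By determinism the existential over runs and outputs collapses to the one labelling
  \<open>s\<close> that satisfies the recursion. From here on runs are labellings and no longer
  lists.\<close>

lemma accepts_Cons_iff:
  assumes "w \<noteq> []" and tr: "\<And>i. i < length w \<Longrightarrow> trans d A w s i = (s i, f i)"
  shows "accepts ((d, A) # C) w \<longleftrightarrow> success d A w s \<and> accepts C (relab w f)"
proof
  assume "accepts ((d, A) # C) w"
  then obtain qs w' where run: "run d A w qs w'" "successful d A w qs" "accepts C w'" by auto
  define s' where "s' i = qs ! state_index d (length w) i" for i
  have tr': "trans d A w s' i = (s' i, fst (w' ! i))" if "i < length w" for i
    using run(1) that unfolding run_iff_trans s'_def by blast
  have eq: "s' i = s i" if "i < length w" for i
    by (rule trans_unique[of w s' d A s]) (use that tr tr' in auto)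
  have "fst (w' ! i) = f i" if "i < length w" for i
    using tr'[OF that] tr[OF that] trans_cong[of i w d s' s A] eq that by auto
  then have "w' = relab w f" using run(1) unfolding run_iff_trans by (intro relabI) auto
  moreover have "success d A w s"
    using run(2) eq unfolding successful_iff_success[OF assms(1)] s'_def[symmetric]
    by (auto simp: success_def)
  ultimately show "success d A w s \<and> accepts C (relab w f)" using run(3) by simp
next
  assume acc: "success d A w s \<and> accepts C (relab w f)"
  \<comment> \<open>States are listed in processing order, so a backward run lists the labelling
    from right to left.\<close>
  define qs where "qs = init A # (case d of Forward \<Rightarrow> map s [0..<length w] | Backward \<Rightarrow> rev (map s [0..<length w]))"
  have qs: "qs ! state_index d (length w) i = s i" if "i < length w" for i
    using that by (cases d) (auto simp: qs_def rev_nth nth_Cons')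
  have "run d A w qs (relab w f)"
    unfolding run_iff_trans
  proof (intro conjI allI impI)
    show "length qs = length w + 1" by (cases d) (auto simp: qs_def)
    show "qs ! 0 = init A" by (simp add: qs_def)
    fix i assume i: "i < length w"
    have "trans d A w (\<lambda>i. qs ! state_index d (length w) i) i = trans d A w s i"
      by (rule trans_cong) (use i qs in auto)
    then show "trans d A w (\<lambda>i. qs ! state_index d (length w) i) i
        = (qs ! state_index d (length w) i, fst (relab w f ! i))"
      using tr i qs by simp
  qed simp
  moreover have "successful d A w qs"
    unfolding successful_iff_success[OF assms(1)] using acc qs by (auto simp: success_def)
  ultimately show "accepts ((d, A) # C) w" using acc by auto
qed

section \<open>Local evaluation of formulas\<close>

text \<open>A truth tree records the truth values of all subformulas at one position. A fixpoint formula
  contributes no node: it has the truth value of its body once its variable denotes the fixpoint.\<close>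

datatype truth_tree = Leaf (root: bool) | Unary (root: bool) (arg: truth_tree)
  | Binary (root: bool) (left: truth_tree) (right: truth_tree)

primrec tree :: "('a, 'd) data_word \<Rightarrow> 'a form \<Rightarrow> (nat \<Rightarrow> nat set) \<Rightarrow> nat \<Rightarrow> truth_tree" where
  "tree w (Var x) V i = Leaf (i \<in> sem w V (Var x))"
| "tree w (Atom A) V i = Leaf (i \<in> sem w V (Atom A))"
| "tree w (NegAtom A) V i = Leaf (i \<in> sem w V (NegAtom A))"
| "tree w (Mod m \<phi>) V i = Unary (i \<in> sem w V (Mod m \<phi>)) (tree w \<phi> V i)"
| "tree w (Or \<phi> \<psi>) V i = Binary (i \<in> sem w V (Or \<phi> \<psi>)) (tree w \<phi> V i) (tree w \<psi> V i)"
| "tree w (And \<phi> \<psi>) V i = Binary (i \<in> sem w V (And \<phi> \<psi>)) (tree w \<phi> V i) (tree w \<psi> V i)"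
| "tree w (Mu x \<phi>) V i = tree w \<phi> (V(x := sem w V (Mu x \<phi>))) i"
| "tree w (Nu x \<phi>) V i = tree w \<phi> (V(x := sem w V (Nu x \<phi>))) i"

lemma sem_Mu_unfold: "sem w V (Mu x \<phi>) = sem w (V(x := sem w V (Mu x \<phi>))) \<phi>"
  unfolding sem.simps by (rule lfp_unfold[OF mono_sem_upd])

lemma sem_Nu_unfold: "sem w V (Nu x \<phi>) = sem w (V(x := sem w V (Nu x \<phi>))) \<phi>"
  unfolding sem.simps by (rule gfp_unfold[OF mono_sem_upd])

lemma root_tree: "root (tree w \<phi> V i) \<longleftrightarrow> i \<in> sem w V \<phi>"
proof (induction \<phi> arbitrary: V)
  case (Mu x \<phi>)
  show ?case unfolding tree.simps Mu.IH sem_Mu_unfold[of w V x \<phi>, symmetric] ..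
next
  case (Nu x \<phi>)
  show ?case unfolding tree.simps Nu.IH sem_Nu_unfold[of w V x \<phi>, symmetric] ..
qed auto

lemma tree_local:
  assumes "\<And>m i j. m \<in> modalities \<phi> \<Longrightarrow> i \<in> D \<Longrightarrow> i < length w \<Longrightarrow> target w m i = Some j \<Longrightarrow> j \<in> D"
    and "\<And>x i. x \<in> free_vars \<phi> \<Longrightarrow> i \<in> D \<Longrightarrow> i < length w \<Longrightarrow> i \<in> V x \<longleftrightarrow> i \<in> V' x"
    and "i \<in> D"
  shows "tree w \<phi> V i = tree w \<phi> V' i"
  using assms
proof (induction \<phi> arbitrary: V V')
  case (Mod m \<phi>)
  have "i \<in> sem w V (Mod m \<phi>) \<longleftrightarrow> i \<in> sem w V' (Mod m \<phi>)" by (rule sem_local[OF Mod.prems]) auto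
  moreover have "tree w \<phi> V i = tree w \<phi> V' i" by (rule Mod.IH) (use Mod.prems in auto)
  ultimately show ?case unfolding tree.simps by simp
next
  case (Or \<phi> \<psi>)
  have "i \<in> sem w V (Or \<phi> \<psi>) \<longleftrightarrow> i \<in> sem w V' (Or \<phi> \<psi>)" by (rule sem_local[OF Or.prems]) auto
  moreover have "tree w \<phi> V i = tree w \<phi> V' i" by (rule Or.IH(1)) (use Or.prems in auto)
  moreover have "tree w \<psi> V i = tree w \<psi> V' i" by (rule Or.IH(2)) (use Or.prems in auto)
  ultimately show ?case unfolding tree.simps by simp
next
  case (And \<phi> \<psi>)
  have "i \<in> sem w V (And \<phi> \<psi>) \<longleftrightarrow> i \<in> sem w V' (And \<phi> \<psi>)" by (rule sem_local[OF And.prems]) auto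
  moreover have "tree w \<phi> V i = tree w \<phi> V' i" by (rule And.IH(1)) (use And.prems in auto)
  moreover have "tree w \<psi> V i = tree w \<psi> V' i" by (rule And.IH(2)) (use And.prems in auto)
  ultimately show ?case unfolding tree.simps by simp
next
  case (Mu x \<phi>)
  have L: "k \<in> sem w V (Mu x \<phi>) \<longleftrightarrow> k \<in> sem w V' (Mu x \<phi>)" if "k \<in> D" for k
    by (rule sem_local[OF Mu.prems(1,2) that]) auto
  show ?case unfolding tree.simps
    by (rule Mu.IH) (use Mu.prems L in \<open>auto simp del: sem.simps\<close>)
next
  case (Nu x \<phi>)
  have L: "k \<in> sem w V (Nu x \<phi>) \<longleftrightarrow> k \<in> sem w V' (Nu x \<phi>)" if "k \<in> D" for k
    by (rule sem_local[OF Nu.prems(1,2) that]) auto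
  show ?case unfolding tree.simps
    by (rule Nu.IH) (use Nu.prems L in \<open>auto simp del: sem.simps\<close>)
qed auto

text \<open>Given the truth trees at the targets of the modalities, membership of a position in a least
  (greatest) fixpoint is decided by evaluating the body with the variable false (true) there.\<close>

primrec local_tree :: "'a form \<Rightarrow> (modality \<Rightarrow> truth_tree option) \<Rightarrow> ('a atom \<Rightarrow> bool) \<Rightarrow> (nat \<Rightarrow> bool) \<Rightarrow> truth_tree"
where
  "local_tree (Var x) T a v = Leaf (v x)"
| "local_tree (Atom A) T a v = Leaf (a A)"
| "local_tree (NegAtom A) T a v = Leaf (\<not> a A)"
| "local_tree (Mod m \<phi>) T a v =
     Unary (case T m of None \<Rightarrow> False | Some t \<Rightarrow> root (arg t)) (local_tree \<phi> (map_option arg \<circ> T) a v)"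
| "local_tree (Or \<phi> \<psi>) T a v =
     (let l = local_tree \<phi> (map_option left \<circ> T) a v; r = local_tree \<psi> (map_option right \<circ> T) a v
      in Binary (root l \<or> root r) l r)"
| "local_tree (And \<phi> \<psi>) T a v =
     (let l = local_tree \<phi> (map_option left \<circ> T) a v; r = local_tree \<psi> (map_option right \<circ> T) a v
      in Binary (root l \<and> root r) l r)"
| "local_tree (Mu x \<phi>) T a v = local_tree \<phi> T a (v(x := root (local_tree \<phi> T a (v(x := False)))))"
| "local_tree (Nu x \<phi>) T a v = local_tree \<phi> T a (v(x := root (local_tree \<phi> T a (v(x := True)))))"

lemma local_tree_cong:
  "(\<And>m. m \<in> modalities \<phi> \<Longrightarrow> T m = T' m) \<Longrightarrow> local_tree \<phi> T a v = local_tree \<phi> T' a v"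
proof (induction \<phi> arbitrary: T T' v)
  case (Mod m \<phi>)
  have "local_tree \<phi> (map_option arg \<circ> T) a v = local_tree \<phi> (map_option arg \<circ> T') a v"
    by (rule Mod.IH) (use Mod.prems in auto)
  then show ?case using Mod.prems by simp
next
  case (Or \<phi> \<psi>)
  have "local_tree \<phi> (map_option left \<circ> T) a v = local_tree \<phi> (map_option left \<circ> T') a v"
    by (rule Or.IH(1)) (use Or.prems in auto)
  moreover have "local_tree \<psi> (map_option right \<circ> T) a v = local_tree \<psi> (map_option right \<circ> T') a v"
    by (rule Or.IH(2)) (use Or.prems in auto)
  ultimately show ?case by simp
next
  case (And \<phi> \<psi>)
  have "local_tree \<phi> (map_option left \<circ> T) a v = local_tree \<phi> (map_option left \<circ> T') a v"
    by (rule And.IH(1)) (use And.prems in auto)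
  moreover have "local_tree \<psi> (map_option right \<circ> T) a v = local_tree \<psi> (map_option right \<circ> T') a v"
    by (rule And.IH(2)) (use And.prems in auto)
  ultimately show ?case by simp
next
  case (Mu x \<phi>)
  have "local_tree \<phi> T a v = local_tree \<phi> T' a v" for v by (rule Mu.IH) (use Mu.prems in auto)
  then show ?case by simp
next
  case (Nu x \<phi>)
  have "local_tree \<phi> T a v = local_tree \<phi> T' a v" for v by (rule Nu.IH) (use Nu.prems in auto)
  then show ?case by simp
qed auto

text \<open>If \<open>i\<close> could be derived only with the help of itself, deleting it would
  leave a smaller prefixed point.\<close>

lemma lfp_iff_remove:
  fixes F :: "'b set \<Rightarrow> 'b set"
  assumes "mono F"
  shows "i \<in> lfp F \<longleftrightarrow> i \<in> F (lfp F - {i})"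
proof
  have sub: "F (lfp F - {i}) \<subseteq> lfp F"
    using monoD[OF assms, of "lfp F - {i}" "lfp F"] lfp_unfold[OF assms] by blast
  show "i \<in> F (lfp F - {i})" if "i \<in> lfp F"
  proof (rule ccontr)
    assume "i \<notin> F (lfp F - {i})"
    then have "lfp F \<subseteq> lfp F - {i}" using sub by (intro lfp_lowerbound) blast
    then show False using that by blast
  qed
  show "i \<in> lfp F" if "i \<in> F (lfp F - {i})" using sub that by blast
qed

text \<open>If assuming \<open>i\<close> suffices to confirm \<open>i\<close>, adding it to the
  greatest fixpoint gives a postfixed point, so it was there already.\<close>

lemma gfp_iff_insert:
  fixes F :: "'b set \<Rightarrow> 'b set"
  assumes "mono F"
  shows "i \<in> gfp F \<longleftrightarrow> i \<in> F (insert i (gfp F))"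
proof
  have sub: "gfp F \<subseteq> F (insert i (gfp F))"
    using monoD[OF assms, of "gfp F" "insert i (gfp F)"] gfp_unfold[OF assms] by blast
  show "i \<in> F (insert i (gfp F))" if "i \<in> gfp F" using sub that by blast
  show "i \<in> gfp F" if "i \<in> F (insert i (gfp F))"
  proof -
    have "insert i (gfp F) \<subseteq> gfp F" using sub that by (intro gfp_upperbound) blast
    then show ?thesis by blast
  qed
qed

text \<open>The two values of \<open>x\<close> differ at most at \<open>i\<close>, and evaluation at
  a target of \<open>i\<close> stays among positions of smaller rank, where \<open>i\<close> is
  never met.\<close>

lemma tree_upd_at_position:
  assumes "modalities \<phi> \<subseteq> dir_mods d" "i < length w" "\<And>k. k \<noteq> i \<Longrightarrow> k \<in> X \<longleftrightarrow> k \<in> Y"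
    "m \<in> modalities \<phi>"
  shows "map_option (tree w \<phi> (V(x := X))) (target w m i) = map_option (tree w \<phi> (V(x := Y))) (target w m i)"
proof (cases "target w m i")
  case (Some j)
  let ?D = "{k. rank d (length w) k < rank d (length w) i}"
  have "tree w \<phi> (V(x := X)) j = tree w \<phi> (V(x := Y)) j"
  proof (rule tree_local[where D = ?D])
    show "k \<in> ?D" if "m' \<in> modalities \<phi>" "l \<in> ?D" "l < length w" "target w m' l = Some k" for m' l k
      using rank_closed[of m' d l w "rank d (length w) i" k] that assms(1) by blast
    show "k \<in> (V(x := X)) y \<longleftrightarrow> k \<in> (V(x := Y)) y" if "k \<in> ?D" for k y
      using that assms(3)[of k] by auto
    show "j \<in> ?D" using target_rank_less[OF assms(2) _ Some, of d] assms(1,4) by blast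
  qed
  then show ?thesis using Some by simp
qed simp

text \<open>This recursion makes the tree computable by a transducer: the right side uses only the
  trees at modal targets and what is known at \<open>i\<close>. In the fixpoint cases the induction
  hypothesis is applied both to the fixpoint and to the fixpoint altered at
  \<open>i\<close>.\<close>

lemma tree_eq_local_tree:
  assumes "modalities \<phi> \<subseteq> dir_mods d" "i < length w"
  shows "tree w \<phi> V i = local_tree \<phi> (\<lambda>m. map_option (tree w \<phi> V) (target w m i))
    (\<lambda>A. atom_holds w A i) (\<lambda>x. i \<in> V x)"
  using assms(1)
proof (induction \<phi> arbitrary: V)
  case (Mod m \<phi>)
  have "i \<in> sem w V (Mod m \<phi>) \<longleftrightarrow>
    (case map_option (tree w (Mod m \<phi>) V) (target w m i) of None \<Rightarrow> False | Some t \<Rightarrow> root (arg t))"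
    using assms(2) by (simp add: root_tree split: option.splits)
  moreover have "map_option arg \<circ> (\<lambda>m'. map_option (tree w (Mod m \<phi>) V) (target w m' i))
      = (\<lambda>m. map_option (tree w \<phi> V) (target w m i))"
    by (auto simp: fun_eq_iff option.map_comp comp_def)
  ultimately show ?case using Mod.IH[of V] Mod.prems
    unfolding local_tree.simps tree.simps(4)[of w m \<phi> V i] by (auto simp del: sem.simps tree.simps)
next
  case (Or \<phi> \<psi>)
  have "map_option left \<circ> (\<lambda>m. map_option (tree w (Or \<phi> \<psi>) V) (target w m i))
      = (\<lambda>m. map_option (tree w \<phi> V) (target w m i))"
    "map_option right \<circ> (\<lambda>m. map_option (tree w (Or \<phi> \<psi>) V) (target w m i))
      = (\<lambda>m. map_option (tree w \<psi> V) (target w m i))"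
    by (auto simp: fun_eq_iff option.map_comp comp_def)
  then show ?case using Or.IH(1)[of V, symmetric] Or.IH(2)[of V, symmetric] Or.prems
    unfolding local_tree.simps tree.simps(5)[of w \<phi> \<psi> V i]
    by (auto simp del: tree.simps simp: Let_def root_tree)
next
  case (And \<phi> \<psi>)
  have "map_option left \<circ> (\<lambda>m. map_option (tree w (And \<phi> \<psi>) V) (target w m i))
      = (\<lambda>m. map_option (tree w \<phi> V) (target w m i))"
    "map_option right \<circ> (\<lambda>m. map_option (tree w (And \<phi> \<psi>) V) (target w m i))
      = (\<lambda>m. map_option (tree w \<psi> V) (target w m i))"
    by (auto simp: fun_eq_iff option.map_comp comp_def)
  then show ?case using And.IH(1)[of V, symmetric] And.IH(2)[of V, symmetric] And.prems
    unfolding local_tree.simps tree.simps(6)[of w \<phi> \<psi> V i]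
    by (auto simp del: tree.simps simp: Let_def root_tree)
next
  case (Mu x \<phi>)
  let ?L = "sem w V (Mu x \<phi>)" let ?a = "\<lambda>A. atom_holds w A i" let ?v = "\<lambda>y. i \<in> V y"
  define T where "T = (\<lambda>X m. map_option (tree w \<phi> (V(x := X))) (target w m i))"
  have mods: "modalities \<phi> \<subseteq> dir_mods d" using Mu.prems by simp
  have IH: "tree w \<phi> (V(x := X)) i = local_tree \<phi> (T X) ?a (?v(x := i \<in> X))" for X
  proof -
    have "(\<lambda>y. i \<in> (V(x := X)) y) = ?v(x := i \<in> X)" by auto
    then show ?thesis using Mu.IH[OF mods, of "V(x := X)"] unfolding T_def by metis
  qed
  \<comment> \<open>Removing \<open>i\<close> sets \<open>x\<close> to false at \<open>i\<close>
    before the answer is known; the trees at the targets are those of the full fixpoint all the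
    same.\<close>
  have "i \<in> ?L \<longleftrightarrow> i \<in> sem w (V(x := ?L - {i})) \<phi>"
    unfolding sem.simps by (rule lfp_iff_remove[OF mono_sem_upd])
  also have "\<dots> \<longleftrightarrow> root (local_tree \<phi> (T (?L - {i})) ?a (?v(x := False)))"
    unfolding root_tree[symmetric] IH by simp
  also have "local_tree \<phi> (T (?L - {i})) ?a (?v(x := False)) = local_tree \<phi> (T ?L) ?a (?v(x := False))"
    unfolding T_def
    by (rule local_tree_cong, rule tree_upd_at_position[OF mods assms(2)]) auto
  finally have "i \<in> ?L \<longleftrightarrow> root (local_tree \<phi> (T ?L) ?a (?v(x := False)))" .
  then show ?case unfolding tree.simps local_tree.simps IH by (simp only: T_def)
next
  case (Nu x \<phi>)
  let ?L = "sem w V (Nu x \<phi>)" let ?a = "\<lambda>A. atom_holds w A i" let ?v = "\<lambda>y. i \<in> V y"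
  define T where "T = (\<lambda>X m. map_option (tree w \<phi> (V(x := X))) (target w m i))"
  have mods: "modalities \<phi> \<subseteq> dir_mods d" using Nu.prems by simp
  have IH: "tree w \<phi> (V(x := X)) i = local_tree \<phi> (T X) ?a (?v(x := i \<in> X))" for X
  proof -
    have "(\<lambda>y. i \<in> (V(x := X)) y) = ?v(x := i \<in> X)" by auto
    then show ?thesis using Nu.IH[OF mods, of "V(x := X)"] unfolding T_def by metis
  qed
  have "i \<in> ?L \<longleftrightarrow> i \<in> sem w (V(x := insert i ?L)) \<phi>"
    unfolding sem.simps by (rule gfp_iff_insert[OF mono_sem_upd])
  also have "\<dots> \<longleftrightarrow> root (local_tree \<phi> (T (insert i ?L)) ?a (?v(x := True)))"
    unfolding root_tree[symmetric] IH by simp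
  also have "local_tree \<phi> (T (insert i ?L)) ?a (?v(x := True)) = local_tree \<phi> (T ?L) ?a (?v(x := True))"
    unfolding T_def
    by (rule local_tree_cong, rule tree_upd_at_position[OF mods assms(2)]) auto
  finally have "i \<in> ?L \<longleftrightarrow> root (local_tree \<phi> (T ?L) ?a (?v(x := True)))" .
  then show ?case unfolding tree.simps local_tree.simps IH by (simp only: T_def)
qed (use assms(2) in auto)

text \<open>The truth values are left arbitrary: the state set only has to be finite and closed
  under \<open>local_tree\<close>.\<close>

primrec trees :: "'a form \<Rightarrow> truth_tree set" where
  "trees (Var x) = range Leaf"
| "trees (Atom A) = range Leaf"
| "trees (NegAtom A) = range Leaf"
| "trees (Mod m \<phi>) = case_prod Unary ` (UNIV \<times> trees \<phi>)"
| "trees (Or \<phi> \<psi>) = (\<lambda>(b, l, r). Binary b l r) ` (UNIV \<times> trees \<phi> \<times> trees \<psi>)"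
| "trees (And \<phi> \<psi>) = (\<lambda>(b, l, r). Binary b l r) ` (UNIV \<times> trees \<phi> \<times> trees \<psi>)"
| "trees (Mu x \<phi>) = trees \<phi>"
| "trees (Nu x \<phi>) = trees \<phi>"

lemma finite_trees: "finite (trees \<phi>)"
  by (induction \<phi>) auto

lemma local_tree_in_trees: "local_tree \<phi> T a v \<in> trees \<phi>"
  by (induction \<phi> arbitrary: T v) (auto simp: Let_def image_iff)

section \<open>From formulas to cascades\<close>

text \<open>A labelling \<open>h\<close> is computed by a cascade that never rejects. Quantifying over the continuation \<open>C'\<close>
  avoids any mention of the intermediate words.\<close>

definition computes ::
  "(nat \<Rightarrow> 'a) \<Rightarrow> 'a set \<Rightarrow> ('a, 'q) cascade \<Rightarrow> (('a, 'd) data_word \<Rightarrow> nat \<Rightarrow> nat) \<Rightarrow> bool" where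
  "computes e \<Sigma> C h \<longleftrightarrow> (\<exists>N. finite N \<and>
     (\<forall>w \<in> data_words \<Sigma>. \<forall>i < length w. h w i \<in> N) \<and>
     (\<forall>C'. is_cascade (e ` N) C' \<longrightarrow> is_cascade \<Sigma> (C @ C')) \<and>
     (\<forall>w \<in> data_words \<Sigma>. \<forall>C'. accepts (C @ C') w \<longleftrightarrow> accepts C' (relab w (\<lambda>i. e (h w i)))))"

lemma computesE:
  assumes "computes e \<Sigma> C h"
  obtains N where "finite N" "\<And>w i. w \<in> data_words \<Sigma> \<Longrightarrow> i < length w \<Longrightarrow> h w i \<in> N"
    "\<And>C'. is_cascade (e ` N) C' \<Longrightarrow> is_cascade \<Sigma> (C @ C')"
    "\<And>w C'. w \<in> data_words \<Sigma> \<Longrightarrow> accepts (C @ C') w \<longleftrightarrow> accepts C' (relab w (\<lambda>i. e (h w i)))"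
  using assms that unfolding computes_def by (elim exE conjE) simp

text \<open>The decoding function is the same for all words and positions, so that a transducer can
  apply it to the current letter.\<close>

definition determines ::
  "'a set \<Rightarrow> (('a, 'd) data_word \<Rightarrow> nat \<Rightarrow> 'l) \<Rightarrow> (('a, 'd) data_word \<Rightarrow> nat \<Rightarrow> 'x) \<Rightarrow> bool" where
  "determines \<Sigma> h X \<longleftrightarrow> (\<exists>f. \<forall>w \<in> data_words \<Sigma>. \<forall>i < length w. X w i = f (h w i))"

lemma determinesI:
  "(\<And>w i. w \<in> data_words \<Sigma> \<Longrightarrow> i < length w \<Longrightarrow> X w i = f (h w i)) \<Longrightarrow> determines \<Sigma> h X"
  unfolding determines_def by blast

lemma determines_refl: "determines \<Sigma> h h"
  by (rule determinesI[where f = "\<lambda>l. l"]) simp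

lemma determines_trans:
  assumes "determines \<Sigma> h X" "determines \<Sigma> X Y"
  shows "determines \<Sigma> h Y"
proof -
  obtain f where "\<And>w i. w \<in> data_words \<Sigma> \<Longrightarrow> i < length w \<Longrightarrow> X w i = f (h w i)"
    using assms(1) by (auto simp: determines_def)
  moreover obtain g where "\<And>w i. w \<in> data_words \<Sigma> \<Longrightarrow> i < length w \<Longrightarrow> Y w i = g (X w i)"
    using assms(2) by (auto simp: determines_def)
  ultimately show ?thesis by (intro determinesI[where f = "\<lambda>l. g (f l)"]) simp
qed

lemma determines_comp: "determines \<Sigma> h X \<Longrightarrow> determines \<Sigma> h (\<lambda>w i. f (X w i))"
  by (erule determines_trans) (rule determinesI[where f = f], rule refl)

lemma determines_Pair:
  assumes "determines \<Sigma> h X" "determines \<Sigma> h Y"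
  shows "determines \<Sigma> h (\<lambda>w i. (X w i, Y w i))"
proof -
  obtain f where "\<And>w i. w \<in> data_words \<Sigma> \<Longrightarrow> i < length w \<Longrightarrow> X w i = f (h w i)"
    using assms(1) by (auto simp: determines_def)
  moreover obtain g where "\<And>w i. w \<in> data_words \<Sigma> \<Longrightarrow> i < length w \<Longrightarrow> Y w i = g (h w i)"
    using assms(2) by (auto simp: determines_def)
  ultimately show ?thesis by (intro determinesI[where f = "\<lambda>l. (f l, g l)"]) simp
qed

lemma determines_fun:
  assumes "\<And>x. determines \<Sigma> h (\<lambda>w i. X w i x)"
  shows "determines \<Sigma> h X"
proof -
  have "\<exists>f. \<forall>w \<in> data_words \<Sigma>. \<forall>i < length w. X w i x = f (h w i)" for x
    using assms[of x] by (auto simp: determines_def)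
  then obtain f where "\<And>x. \<forall>w \<in> data_words \<Sigma>. \<forall>i < length w. X w i x = f x (h w i)" by metis
  then show ?thesis by (intro determinesI[where f = "\<lambda>l x. f x l"]) auto
qed

text \<open>The letters written by the constructed transducers, and their states, are drawn from two
  injected copies of the natural numbers.\<close>

locale coding =
  fixes e :: "nat \<Rightarrow> 'a" and c :: "nat \<Rightarrow> 'q" and \<Sigma> :: "'a set"
  assumes inj_e: "inj e" and inj_c: "inj c" and finite_\<Sigma>: "finite \<Sigma>"
begin

text \<open>The letters of \<open>\<Sigma>\<close> need not lie in the range of \<open>e\<close>. A
  one-state transducer recodes them, which gives a first cascade to extend.\<close>

lemma computes_letter:
  "\<exists>(C :: ('a, 'q) cascade) h. computes e \<Sigma> C (h :: ('a, 'd) data_word \<Rightarrow> nat \<Rightarrow> nat) \<and>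
    determines \<Sigma> h (\<lambda>w i. fst (w ! i))"
proof -
  obtain k :: "'a \<Rightarrow> nat" where k: "inj_on k \<Sigma>" using finite_imp_inj_to_nat_seg[OF finite_\<Sigma>] by blast
  define A :: "('a, 'q) cmt" where "A = \<lparr>states = {c 0}, in_alphabet = \<Sigma>, out_alphabet = e ` k ` \<Sigma>,
    delta = \<lambda>_ _ a _. (c 0, e (k a)), init = c 0, class_final = {c 0}, global_final = {c 0}\<rparr>"
  define h :: "('a, 'd) data_word \<Rightarrow> nat \<Rightarrow> nat" where "h w i = k (fst (w ! i))" for w i
  have letter: "fst (w ! i) \<in> \<Sigma>" if "w \<in> data_words \<Sigma>" "i < length w" for w :: "('a, 'd) data_word" and i
    using that by (auto simp: data_words_def)
  have "computes e \<Sigma> [(Forward, A)] h"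
    unfolding computes_def
  proof (intro exI[of _ "k ` \<Sigma>"] conjI ballI allI impI)
    show "finite (k ` \<Sigma>)" using finite_\<Sigma> by simp
    show "h w i \<in> k ` \<Sigma>" if "w \<in> data_words \<Sigma>" "i < length w" for w i
      using letter[OF that] by (simp add: h_def)
    show "is_cascade \<Sigma> ([(Forward, A)] @ C')" if "is_cascade (e ` k ` \<Sigma>) C'" for C'
      using that finite_\<Sigma> by (simp add: is_cmt_def A_def)
    show "accepts ([(Forward, A)] @ C') w \<longleftrightarrow> accepts C' (relab w (\<lambda>i. e (h w i)))"
      if "w \<in> data_words \<Sigma>" for w C'
    proof -
      have "accepts ((Forward, A) # C') w \<longleftrightarrow>
        success Forward A w (\<lambda>_. c 0) \<and> accepts C' (relab w (\<lambda>i. e (h w i)))"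
        by (rule accepts_Cons_iff) (use that in \<open>auto simp: data_words_def trans_def A_def h_def\<close>)
      moreover have "success Forward A w (\<lambda>_. c 0)" by (simp add: success_def A_def)
      ultimately show ?thesis by simp
    qed
  qed
  moreover have "determines \<Sigma> h (\<lambda>w i. fst (w ! i))"
    by (rule determinesI[where f = "inv_into \<Sigma> k"]) (use k letter in \<open>simp add: h_def\<close>)
  ultimately show ?thesis by blast
qed

text \<open>The value of \<open>g\<close> is itself the state, so the previous state and the memory
  supply \<open>g\<close> at the two targets. The output pairs the old letter with the new value, so
  later passes still see all that was computed; making every state final prevents rejection.\<close>

lemma computes_extend:
  fixes h :: "('a, 'd) data_word \<Rightarrow> nat \<Rightarrow> nat" and C :: "('a, 'q) cascade"
    and g :: "('a, 'd) data_word \<Rightarrow> nat \<Rightarrow> 's"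
  assumes comp: "computes e \<Sigma> C h" and "determines \<Sigma> h X" and fin: "finite T"
    and st: "\<And>p m x t. st p m x t \<in> T"
    and g: "\<And>w i. w \<in> data_words \<Sigma> \<Longrightarrow> i < length w \<Longrightarrow>
      g w i = st (map_option (g w) (target w (step_mod d) i)) (map_option (g w) (target w (class_mod d) i))
        (X w i) (tp w i)"
  shows "\<exists>(C' :: ('a, 'q) cascade) h'. computes e \<Sigma> C' h' \<and> determines \<Sigma> h' h \<and> determines \<Sigma> h' g"
proof -
  obtain f where f: "\<And>w i. w \<in> data_words \<Sigma> \<Longrightarrow> i < length w \<Longrightarrow> X w i = f (h w i)"
    using assms(2) by (auto simp: determines_def)
  obtain N where N: "finite N" "\<And>w i. w \<in> data_words \<Sigma> \<Longrightarrow> i < length w \<Longrightarrow> h w i \<in> N"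
    and casc: "\<And>C'. is_cascade (e ` N) C' \<Longrightarrow> is_cascade \<Sigma> (C @ C')"
    and acc: "\<And>w C'. w \<in> data_words \<Sigma> \<Longrightarrow> accepts (C @ C') w \<longleftrightarrow> accepts C' (relab w (\<lambda>i. e (h w i)))"
    using comp by (rule computesE) simp
  obtain k :: "'s \<Rightarrow> nat" where k: "inj_on k T" using finite_imp_inj_to_nat_seg[OF fin] by blast
  \<comment> \<open>The successor reserves \<open>c 0\<close> for the initial state, by which
    \<open>nxt\<close> recognises that no position was read before.\<close>
  define s where "s x = c (Suc (k x))" for x
  define s' where "s' = inv_into T s"
  have s_inj: "inj_on s T"
    by (rule inj_onI) (use k in \<open>auto simp: s_def inj_eq[OF inj_c] dest: inj_onD\<close>)
  have s': "s' (s x) = x" if "x \<in> T" for x using s_inj that by (simp add: s'_def)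
  have s0: "s x \<noteq> c 0" for x by (simp add: s_def inj_eq[OF inj_c])
  have gT: "g w i \<in> T" if "w \<in> data_words \<Sigma>" "i < length w" for w i using g[OF that] st by simp
  define nxt where "nxt q m l t = st (if q = c 0 then None else Some (s' q))
    (case m of State r \<Rightarrow> Some (s' r) | _ \<Rightarrow> None) (f (inv e l)) t" for q m l t
  define A where "A = \<lparr>states = insert (c 0) (s ` T), in_alphabet = e ` N,
    out_alphabet = e ` prod_encode ` (N \<times> k ` T),
    delta = \<lambda>q m l t. (s (nxt q m l t), e (prod_encode (inv e l, k (nxt q m l t)))),
    init = c 0, class_final = insert (c 0) (s ` T), global_final = insert (c 0) (s ` T)\<rparr>"
  define h' where "h' w i = prod_encode (h w i, k (g w i))" for w :: "('a, 'd) data_word" and i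
  have inv_e: "inv e (e l) = l" for l using inj_e by simp
  have cmt: "is_cmt A"
    using N(1) fin st by (auto simp: is_cmt_def A_def inv_e nxt_def)
  have tr: "trans d A (relab w (\<lambda>i. e (h w i))) (\<lambda>i. s (g w i)) i = (s (g w i), e (h' w i))"
    if w: "w \<in> data_words \<Sigma>" and i: "i < length w" for w i
  proof -
    have T: "g w j \<in> T" if "target w m i = Some j" for m j
      using gT[OF w] target_less_length[OF i that] by simp
    have "nxt (case target w (step_mod d) i of None \<Rightarrow> c 0 | Some j \<Rightarrow> s (g w j))
       (case target w (class_mod d) i of None \<Rightarrow> empty_memory d | Some j \<Rightarrow> State (s (g w j)))
       (e (h w i)) (tp w i) = g w i"
      unfolding g[OF w i] nxt_def using T f[OF w i]
      by (cases d) (auto simp: inv_e s' s0 simp del: target.simps split: option.splits)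
    then show ?thesis using i by (simp add: trans_def A_def h'_def inv_e cong: option.case_cong)
  qed
  have "computes e \<Sigma> (C @ [(d, A)]) h'"
    unfolding computes_def
  proof (intro exI[of _ "prod_encode ` (N \<times> k ` T)"] conjI ballI allI impI)
    show "finite (prod_encode ` (N \<times> k ` T))" using N(1) fin by simp
    show "h' w i \<in> prod_encode ` (N \<times> k ` T)" if "w \<in> data_words \<Sigma>" "i < length w" for w i
      using N(2)[OF that] gT[OF that] by (simp add: h'_def)
    show "is_cascade \<Sigma> ((C @ [(d, A)]) @ C')" if "is_cascade (e ` prod_encode ` (N \<times> k ` T)) C'" for C'
      using casc[of "(d, A) # C'"] that cmt by (simp add: A_def)
    show "accepts ((C @ [(d, A)]) @ C') w \<longleftrightarrow> accepts C' (relab w (\<lambda>i. e (h' w i)))"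
      if w: "w \<in> data_words \<Sigma>" for w C'
    proof -
      let ?w = "relab w (\<lambda>i. e (h w i))"
      have "accepts ((C @ [(d, A)]) @ C') w \<longleftrightarrow> accepts ((d, A) # C') ?w"
        using acc[OF w, of "(d, A) # C'"] by simp
      also have "\<dots> \<longleftrightarrow> success d A ?w (\<lambda>i. s (g w i)) \<and> accepts C' (relab ?w (\<lambda>i. e (h' w i)))"
        by (rule accepts_Cons_iff) (use w tr in \<open>auto simp: data_words_def\<close>)
      also have "\<dots> \<longleftrightarrow> accepts C' (relab w (\<lambda>i. e (h' w i)))"
        using gT[OF w] by (simp add: success_def A_def)
      finally show ?thesis .
    qed
  qed
  moreover have "determines \<Sigma> h' h"
    by (rule determinesI[where f = "\<lambda>l. fst (prod_decode l)"]) (simp add: h'_def)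
  moreover have "determines \<Sigma> h' g"
    by (rule determinesI[where f = "\<lambda>l. inv_into T k (snd (prod_decode l))"]) (use k gT in \<open>simp add: h'_def\<close>)
  ultimately show ?thesis by blast
qed

text \<open>Each of the atoms \<open>FirstG\<close>, \<open>FirstC\<close> (\<open>LastG\<close>, \<open>LastC\<close>) is visible only to a forward (backward)
  transducer, namely in the use of the initial state and of the empty memory.\<close>

lemma computes_atoms:
  "\<exists>(C :: ('a, 'q) cascade) h. computes e \<Sigma> C (h :: ('a, 'd) data_word \<Rightarrow> nat \<Rightarrow> nat) \<and>
    determines \<Sigma> h (\<lambda>w i A. atom_holds w A i)"
proof -
  obtain C0 :: "('a, 'q) cascade" and h0 :: "('a, 'd) data_word \<Rightarrow> nat \<Rightarrow> nat"
    where 0: "computes e \<Sigma> C0 h0" "determines \<Sigma> h0 (\<lambda>w i. fst (w ! i))"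
    using computes_letter by blast
  let ?X = "\<lambda>d w i. (target w (step_mod d) i = None, target w (class_mod d) i = None, tp w i)"
  have ext: "\<exists>(C' :: ('a, 'q) cascade) h'. computes e \<Sigma> C' h' \<and> determines \<Sigma> h' h \<and> determines \<Sigma> h' (?X d)"
    if "computes e \<Sigma> C h" for d and C :: "('a, 'q) cascade" and h :: "('a, 'd) data_word \<Rightarrow> nat \<Rightarrow> nat"
    by (rule computes_extend[OF that determines_refl, where T = UNIV and d = d
          and st = "\<lambda>p m _ t. (p = None, m = None, t)"]) auto
  obtain C1 :: "('a, 'q) cascade" and h1 where 1: "computes e \<Sigma> C1 h1" "determines \<Sigma> h1 h0" "determines \<Sigma> h1 (?X Forward)"
    using ext[OF 0(1)] by blast
  obtain C2 :: "('a, 'q) cascade" and h2 where 2: "computes e \<Sigma> C2 h2" "determines \<Sigma> h2 h1" "determines \<Sigma> h2 (?X Backward)"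
    using ext[OF 1(1)] by blast
  have "determines \<Sigma> h2 (\<lambda>w i. (fst (w ! i), ?X Forward w i, ?X Backward w i))"
    by (rule determines_Pair[OF determines_trans[OF 2(2) determines_trans[OF 1(2) 0(2)]]
          determines_Pair[OF determines_trans[OF 2(2) 1(3)] 2(3)]])
  then have "determines \<Sigma> h2 (\<lambda>w i A. atom_holds w A i)"
  proof (rule determines_trans)
    let ?f = "\<lambda>(l, (fg, fc, (p, s)), (lg, lc, _ :: marking)) A. (case A of Letter a \<Rightarrow> l = a | AtomS \<Rightarrow> s | AtomP \<Rightarrow> p
      | FirstG \<Rightarrow> fg | LastG \<Rightarrow> lg | FirstC \<Rightarrow> fc | LastC \<Rightarrow> lc)"
    show "determines \<Sigma> (\<lambda>w i. (fst (w ! i), ?X Forward w i, ?X Backward w i))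
      (\<lambda>(w :: ('a, 'd) data_word) i A. atom_holds w A i)"
    proof (rule determinesI[where f = ?f])
      fix w :: "('a, 'd) data_word" and i assume "i < length w"
      then show "(\<lambda>A. atom_holds w A i) = ?f (fst (w ! i), ?X Forward w i, ?X Backward w i)"
        by (auto simp: fun_eq_iff tp_def split: atom.split)
    qed
  qed
  then show ?thesis using 2(1) by blast
qed

text \<open>Three facts combine: the trees form a finite set, \<open>tree_eq_local_tree\<close> is a
  recursion of the form that \<open>computes_extend\<close> asks for, and the root of the tree is
  the wanted truth value.\<close>

lemma computes_formula:
  fixes h :: "('a, 'd) data_word \<Rightarrow> nat \<Rightarrow> nat" and C :: "('a, 'q) cascade"
  assumes "computes e \<Sigma> C h" "determines \<Sigma> h (\<lambda>w i A. atom_holds w A i)"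
    and mods: "modalities \<phi> \<subseteq> dir_mods d"
    and V: "\<And>x. x \<in> free_vars \<phi> \<Longrightarrow> determines \<Sigma> h (\<lambda>w i. i \<in> V w x)"
  shows "\<exists>(C' :: ('a, 'q) cascade) h'. computes e \<Sigma> C' h' \<and> determines \<Sigma> h' h \<and>
    determines \<Sigma> h' (\<lambda>w i. i \<in> sem w (V w) \<phi>)"
proof -
  \<comment> \<open>Only the free variables are known to be readable from the letters; emptying the
    others makes the whole valuation readable and leaves the semantics unchanged.\<close>
  define V' where "V' w x = (if x \<in> free_vars \<phi> then V w x else {})" for w x
  have sem: "sem w (V' w) \<phi> = sem w (V w) \<phi>" for w by (rule sem_cong) (simp add: V'_def)
  let ?X = "\<lambda>w i. (\<lambda>A. atom_holds w A i, \<lambda>x. i \<in> V' w x)"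
  define st where "st p m x (t :: marking) = local_tree \<phi>
    (\<lambda>m'. if m' = step_mod d then p else m) (fst x) (snd x)" for p m x t
  have "determines \<Sigma> h (\<lambda>w i x. i \<in> V' w x)"
  proof (rule determines_fun)
    show "determines \<Sigma> h (\<lambda>w i. i \<in> V' w x)" for x
      using V[of x] by (cases "x \<in> free_vars \<phi>") (auto simp: V'_def intro: determinesI[where f = "\<lambda>_. False"])
  qed
  with assms(2) have X: "determines \<Sigma> h ?X" by (rule determines_Pair)
  obtain C' :: "('a, 'q) cascade" and h' where C': "computes e \<Sigma> C' h'" "determines \<Sigma> h' h"
    and t: "determines \<Sigma> h' (\<lambda>w. tree w \<phi> (V' w))"
  proof atomize_elim
    show "\<exists>(C' :: ('a, 'q) cascade) h'. computes e \<Sigma> C' h' \<and> determines \<Sigma> h' h \<and> determines \<Sigma> h' (\<lambda>w. tree w \<phi> (V' w))"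
    proof (rule computes_extend[OF assms(1) X finite_trees, of st \<phi> "\<lambda>w. tree w \<phi> (V' w)" d])
      show "st p m x t \<in> trees \<phi>" for p m x t unfolding st_def by (rule local_tree_in_trees)
      fix w :: "('a, 'd) data_word" and i assume i: "i < length w"
      show "tree w \<phi> (V' w) i = st (map_option (tree w \<phi> (V' w)) (target w (step_mod d) i))
          (map_option (tree w \<phi> (V' w)) (target w (class_mod d) i)) (?X w i) (tp w i)"
        unfolding tree_eq_local_tree[OF mods i] st_def fst_conv snd_conv
        by (rule local_tree_cong) (use mods in auto)
    qed
  qed
  from determines_comp[OF t, of root] have "determines \<Sigma> h' (\<lambda>w i. i \<in> sem w (V w) \<phi>)"
    unfolding root_tree sem .
  then show ?thesis using C' by blast
qed

text \<open>Keeping \<open>C\<close> and \<open>h\<close> arbitrary in the induction lets the passes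
  for the substituted sentences be appended one after another. Each keeps what was known, and in the
  end their truth values form the valuation for the outer formula.\<close>

lemma computes_Comp_level:
  fixes h :: "('a, 'd) data_word \<Rightarrow> nat \<Rightarrow> nat" and C :: "('a, 'q) cascade"
  assumes "\<phi> \<in> Comp_level l (BR_base \<Sigma>)"
    and "computes e \<Sigma> C h" "determines \<Sigma> h (\<lambda>w i A. atom_holds w A i)"
  shows "\<exists>(C' :: ('a, 'q) cascade) h'. computes e \<Sigma> C' h' \<and> determines \<Sigma> h' h \<and>
    determines \<Sigma> h' (\<lambda>w i. i \<in> sem w (\<lambda>_. {}) \<phi>)"
  using assms
proof (induction l arbitrary: \<phi> C h)
  case (Suc l)
  then obtain \<sigma> \<psi> where \<phi>: "\<phi> = subst \<sigma> \<psi>" and \<psi>: "\<psi> \<in> BR_base \<Sigma>"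
    and \<sigma>: "\<forall>x \<in> free_vars \<psi>. \<sigma> x \<in> Comp_level l (BR_base \<Sigma>)" by auto
  have "\<exists>(C' :: ('a, 'q) cascade) h'. computes e \<Sigma> C' h' \<and> determines \<Sigma> h' h \<and>
    (\<forall>x \<in> F. determines \<Sigma> h' (\<lambda>w i. i \<in> sem w (\<lambda>_. {}) (\<sigma> x)))"
    if "finite F" "F \<subseteq> free_vars \<psi>" for F
    using that
  proof (induction F rule: finite_induct)
    case empty
    then show ?case using Suc.prems(2) determines_refl by blast
  next
    case (insert x F)
    then obtain C1 :: "('a, 'q) cascade" and h1 where 1: "computes e \<Sigma> C1 h1" "determines \<Sigma> h1 h"
      "\<forall>x \<in> F. determines \<Sigma> h1 (\<lambda>w i. i \<in> sem w (\<lambda>_. {}) (\<sigma> x))" by blast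
    have "\<sigma> x \<in> Comp_level l (BR_base \<Sigma>)" using \<sigma> insert.prems by blast
    from Suc.IH[OF this 1(1) determines_trans[OF 1(2) Suc.prems(3)]]
    obtain C2 :: "('a, 'q) cascade" and h2 where 2: "computes e \<Sigma> C2 h2" "determines \<Sigma> h2 h1"
      "determines \<Sigma> h2 (\<lambda>w i. i \<in> sem w (\<lambda>_. {}) (\<sigma> x))" by blast
    have "\<forall>y \<in> insert x F. determines \<Sigma> h2 (\<lambda>w i. i \<in> sem w (\<lambda>_. {}) (\<sigma> y))"
      using 1(3) 2(3) determines_trans[OF 2(2)] by blast
    then show ?case using 2(1) determines_trans[OF 2(2) 1(2)] by blast
  qed
  from this[OF finite_free_vars order_refl]
  obtain C1 :: "('a, 'q) cascade" and h1 where 1: "computes e \<Sigma> C1 h1" "determines \<Sigma> h1 h"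
    "\<forall>x \<in> free_vars \<psi>. determines \<Sigma> h1 (\<lambda>w i. i \<in> sem w (\<lambda>_. {}) (\<sigma> x))" by blast
  obtain d where mods: "modalities \<psi> \<subseteq> dir_mods d"
  proof -
    have "modalities \<psi> \<subseteq> dir_mods Backward \<or> modalities \<psi> \<subseteq> dir_mods Forward"
      using \<psi> unfolding Formulas_def by auto
    then show ?thesis using that by blast
  qed
  from computes_formula[OF 1(1) determines_trans[OF 1(2) Suc.prems(3)] mods,
      of "\<lambda>w z. sem w (\<lambda>_. {}) (\<sigma> z)"] 1(3)
  obtain C2 :: "('a, 'q) cascade" and h2 where 2: "computes e \<Sigma> C2 h2" "determines \<Sigma> h2 h1"
    "determines \<Sigma> h2 (\<lambda>w i. i \<in> sem w (\<lambda>z. sem w (\<lambda>_. {}) (\<sigma> z)) \<psi>)" by blast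
  then show ?case unfolding \<phi> sem_subst_Comp[OF \<sigma>] using determines_trans[OF 2(2) 1(2)] by blast
qed simp

lemma cascade_for_formula:
  assumes "\<phi> \<in> BR \<Sigma>"
  shows "\<exists>C \<in> (cascades \<Sigma> :: ('a, 'q) cascade set).
    \<forall>w \<in> (data_words \<Sigma> :: ('a, 'd) data_word set). accepts C w \<longleftrightarrow> models w \<phi>"
proof -
  obtain l where l: "\<phi> \<in> Comp_level l (BR_base \<Sigma>)" using assms by (auto simp: BR_def Comp_def)
  obtain C0 :: "('a, 'q) cascade" and h0 :: "('a, 'd) data_word \<Rightarrow> nat \<Rightarrow> nat"
    where 0: "computes e \<Sigma> C0 h0" "determines \<Sigma> h0 (\<lambda>w i A. atom_holds w A i)"
    using computes_atoms by blast
  obtain C :: "('a, 'q) cascade" and h :: "('a, 'd) data_word \<Rightarrow> nat \<Rightarrow> nat"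
    where C: "computes e \<Sigma> C h" "determines \<Sigma> h (\<lambda>w i. i \<in> sem w (\<lambda>_. {}) \<phi>)"
    using computes_Comp_level[OF l 0] by blast
  obtain f where f: "\<And>w i. w \<in> data_words \<Sigma> \<Longrightarrow> i < length w \<Longrightarrow> i \<in> sem w (\<lambda>_. {}) \<phi> \<longleftrightarrow> f (h w i)"
    using C(2) by (auto simp: determines_def)
  obtain N where N: "finite N" and casc: "\<And>C'. is_cascade (e ` N) C' \<Longrightarrow> is_cascade \<Sigma> (C @ C')"
    and acc: "\<And>w C'. w \<in> data_words \<Sigma> \<Longrightarrow> accepts (C @ C') w \<longleftrightarrow> accepts C' (relab w (\<lambda>i. e (h w i)))"
    using C(1) by (rule computesE) simp
  define r where "r b = (if b then c 1 else c 0)" for b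
  have r: "r b = c 1 \<longleftrightarrow> b" for b by (simp add: r_def inj_eq[OF inj_c])
  \<comment> \<open>A backward run ends at position 0, where sentences are evaluated, so its last
    state can be used as the verdict.\<close>
  define A where "A = \<lparr>states = range r, in_alphabet = e ` N, out_alphabet = e ` N,
    delta = \<lambda>_ _ a _. (r (f (inv e a)), a), init = r False, class_final = range r, global_final = {r True}\<rparr>"
  have "C @ [(Backward, A)] \<in> cascades \<Sigma>"
    unfolding cascades_def using N by (auto intro!: casc simp: is_cmt_def A_def)
  moreover have "accepts (C @ [(Backward, A)]) w \<longleftrightarrow> models w \<phi>" if w: "w \<in> data_words \<Sigma>"
    for w :: "('a, 'd) data_word"
  proof -
    let ?w = "relab w (\<lambda>i. e (h w i))" and ?s = "\<lambda>i. r (f (h w i))"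
    have ne: "w \<noteq> []" using w by (simp add: data_words_def)
    have "accepts (C @ [(Backward, A)]) w \<longleftrightarrow> accepts [(Backward, A)] ?w" by (rule acc[OF w])
    also have "\<dots> \<longleftrightarrow> success Backward A ?w ?s \<and> accepts ([] :: ('a, 'q) cascade) (relab ?w (\<lambda>i. e (h w i)))"
      by (rule accepts_Cons_iff) (use ne inj_e in \<open>auto simp: trans_def A_def\<close>)
    also have "\<dots> \<longleftrightarrow> f (h w 0)"
      using ne r by (auto simp: success_def A_def r_def)
    also have "\<dots> \<longleftrightarrow> models w \<phi>"
      using f[OF w, of 0] ne by (simp add: models_def)
    finally show ?thesis .
  qed
  ultimately show ?thesis by blast
qed

end

section \<open>From cascades to formulas\<close>

text \<open>Built without letters and modalities, so that it is available in both
  directions.\<close>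

definition bot_form :: "'a form" where
  "bot_form = And (Atom FirstG) (NegAtom FirstG)"

definition big_or :: "('x \<Rightarrow> 'a form) \<Rightarrow> 'x set \<Rightarrow> 'a form" where
  "big_or f X = foldr (\<lambda>x. Or (f x)) (SOME xs. set xs = X) bot_form"

lemma sem_bot_form [simp]: "sem w V bot_form = {}"
  by (auto simp: bot_form_def)

lemma set_some_list: "finite X \<Longrightarrow> set (SOME xs. set xs = X) = X"
  by (rule someI_ex) (rule finite_list)

lemma sem_big_or:
  assumes "finite X"
  shows "sem w V (big_or f X) = (\<Union>x\<in>X. sem w V (f x))"
proof -
  have "sem w V (foldr (\<lambda>x. Or (f x)) xs bot_form) = (\<Union>x\<in>set xs. sem w V (f x))" for xs
    by (induction xs) auto
  then show ?thesis by (simp add: big_or_def set_some_list[OF assms])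
qed

text \<open>The formulas describing a transducer mention no letters: the letters of its input word are not
  letters of the original word and enter through free variables.\<close>

definition dir_form :: "direction \<Rightarrow> nat set \<Rightarrow> 'a form \<Rightarrow> bool" where
  "dir_form d F \<phi> \<longleftrightarrow> set_form \<phi> = {} \<and> modalities \<phi> \<subseteq> dir_mods d \<and> free_vars \<phi> \<subseteq> F"

lemma dir_form_simps [simp]:
  "dir_form d F (Var x) \<longleftrightarrow> x \<in> F"
  "dir_form d F (Atom A) \<longleftrightarrow> set_atom A = {}"
  "dir_form d F (NegAtom A) \<longleftrightarrow> set_atom A = {}"
  "dir_form d F (Mod m \<phi>) \<longleftrightarrow> m \<in> dir_mods d \<and> dir_form d F \<phi>"
  "dir_form d F (Or \<phi> \<psi>) \<longleftrightarrow> dir_form d F \<phi> \<and> dir_form d F \<psi>"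
  "dir_form d F (And \<phi> \<psi>) \<longleftrightarrow> dir_form d F \<phi> \<and> dir_form d F \<psi>"
  "dir_form d F (Mu x \<phi>) \<longleftrightarrow> dir_form d (insert x F) \<phi>"
  "dir_form d F bot_form"
  by (auto simp: dir_form_def bot_form_def)

lemma dir_form_big_or:
  assumes "finite X" "\<And>x. x \<in> X \<Longrightarrow> dir_form d F (f x)"
  shows "dir_form d F (big_or f X)"
proof -
  have "(\<forall>x \<in> set xs. dir_form d F (f x)) \<Longrightarrow> dir_form d F (foldr (\<lambda>x. Or (f x)) xs bot_form)" for xs
    by (induction xs) auto
  then show ?thesis using assms by (simp add: big_or_def set_some_list)
qed

lemma dir_form_BR_base: "dir_form d F \<phi> \<Longrightarrow> \<phi> \<in> BR_base \<Sigma>"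
  using Formulas_dir_BR_base[of \<Sigma> d] by (auto simp: dir_form_def Formulas_def)

fun start_atom :: "direction \<Rightarrow> 'a atom" where
  "start_atom Forward = FirstG"
| "start_atom Backward = LastG"

fun class_start_atom :: "direction \<Rightarrow> 'a atom" where
  "class_start_atom Forward = FirstC"
| "class_start_atom Backward = LastC"

lemma atom_holds_start:
  assumes "i < length w"
  shows "atom_holds w (start_atom d) i \<longleftrightarrow> target w (step_mod d) i = None"
    and "atom_holds w (class_start_atom d) i \<longleftrightarrow> target w (class_mod d) i = None"
  using assms by (cases d; auto)+

lemma empty_memory_neq [simp]: "empty_memory d \<noteq> State q" "State q \<noteq> empty_memory d"
  by (cases d; simp)+

lemma set_start_atom [simp]: "set_atom (start_atom d) = {}" "set_atom (class_start_atom d) = {}"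
  by (cases d; simp)+

fun mark_form :: "marking \<Rightarrow> 'a form" where
  "mark_form (p, s) =
     And (if p then Atom AtomP else NegAtom AtomP) (if s then Atom AtomS else NegAtom AtomS)"

lemma mark_form [simp]:
  "i < length w \<Longrightarrow> i \<in> sem w V (mark_form t) \<longleftrightarrow> t = tp w i" "dir_form d F (mark_form t)"
  by (cases t; auto simp: tp_def)+

section \<open>Formulas describing a single transducer\<close>

definition letter_valuation :: "('a \<Rightarrow> nat) \<Rightarrow> 'a set \<Rightarrow> nat \<Rightarrow> (nat \<Rightarrow> 'a) \<Rightarrow> (nat \<Rightarrow> nat set) \<Rightarrow> bool" where
  "letter_valuation va \<Gamma> n lab V \<longleftrightarrow> (\<forall>a \<in> \<Gamma>. V (va a) = {i. i < n \<and> lab i = a})"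

text \<open>State variables get bound inside the formulas, letter variables stay free until
  composition replaces them; disjoint ranges keep the two from interfering.\<close>

locale transducer =
  fixes A :: "('a, 'q) cmt" and d :: direction and vs :: "'q \<Rightarrow> nat" and va :: "'a \<Rightarrow> nat"
  assumes cmt: "is_cmt A"
    and inj_vs: "inj_on vs (states A)" and inj_va: "inj_on va (in_alphabet A)"
    and vs_va: "vs ` states A \<inter> va ` in_alphabet A = {}"
begin

text \<open>The transducer reads \<open>w\<close> relabelled by \<open>lab\<close>, whereas all
  formulas are evaluated over \<open>w\<close> itself.\<close>

definition labels_run :: "('a, 'd) data_word \<Rightarrow> (nat \<Rightarrow> 'a) \<Rightarrow> (nat \<Rightarrow> 'q) \<Rightarrow> bool" where
  "labels_run w lab s \<longleftrightarrow>
     (\<forall>i < length w. lab i \<in> in_alphabet A \<and> s i = fst (trans d A (relab w lab) s i))"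

abbreviation memories :: "'q memory set" where
  "memories \<equiv> insert (empty_memory d) (State ` states A)"

lemma finite_sets: "finite (states A)" "finite (in_alphabet A)" "finite (class_final A)" "finite (global_final A)"
  "finite (states A \<times> memories \<times> in_alphabet A \<times> (UNIV :: marking set))"
  using cmt by (auto simp: is_cmt_def intro: finite_subset)

lemma delta_closed:
  assumes "q \<in> states A" "m \<in> memories" "a \<in> in_alphabet A"
  shows "fst (delta A q m a t) \<in> states A" "snd (delta A q m a t) \<in> out_alphabet A"
proof -
  have "m \<in> {Top, Bot} \<union> State ` states A" using assms(2) by (cases d) auto
  then have "delta A q m a t \<in> states A \<times> out_alphabet A"
    using cmt assms(1,3) unfolding is_cmt_def by blast
  then show "fst (delta A q m a t) \<in> states A" "snd (delta A q m a t) \<in> out_alphabet A" by auto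
qed

abbreviation previous_state :: "('a, 'd) data_word \<Rightarrow> (nat \<Rightarrow> 'q) \<Rightarrow> nat \<Rightarrow> 'q" where
  "previous_state w s i \<equiv> (case target w (step_mod d) i of None \<Rightarrow> init A | Some j \<Rightarrow> s j)"

abbreviation memory_at :: "('a, 'd) data_word \<Rightarrow> (nat \<Rightarrow> 'q) \<Rightarrow> nat \<Rightarrow> 'q memory" where
  "memory_at w s i \<equiv> (case target w (class_mod d) i of None \<Rightarrow> empty_memory d | Some j \<Rightarrow> State (s j))"

lemma trans_relab:
  "i < length w \<Longrightarrow>
    trans d A (relab w lab) s i = delta A (previous_state w s i) (memory_at w s i) (lab i) (tp w i)"
  by (simp add: trans_def)

text \<open>\<open>labels_run\<close> only states the recursion; that its values stay in the state
  set follows along the processing order.\<close>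

lemma labels_run_closed:
  assumes "labels_run w lab s" "i < length w"
  shows "s i \<in> states A \<and> previous_state w s i \<in> states A \<and> memory_at w s i \<in> memories"
  using assms(2)
proof (induction "rank d (length w) i" arbitrary: i rule: less_induct)
  case less
  have s: "s j \<in> states A" if "m \<in> dir_mods d" "target w m i = Some j" for m j
    using less.hyps[OF target_rank_less[OF less.prems that] target_less_length[OF less.prems that(2)]] by blast
  have p: "previous_state w s i \<in> states A"
    using s[of "step_mod d"] cmt by (auto simp: is_cmt_def split: option.split)
  have m: "memory_at w s i \<in> memories"
    using s[of "class_mod d"] by (auto split: option.split)
  have "lab i \<in> in_alphabet A" "s i = fst (trans d A (relab w lab) s i)"
    using assms(1) less.prems by (auto simp: labels_run_def)
  then show ?case using delta_closed(1)[OF p m] p m trans_relab[OF less.prems] by metis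
qed

lemma labels_run_out:
  assumes "labels_run w lab s" "i < length w"
  shows "snd (trans d A (relab w lab) s i) \<in> out_alphabet A"
  using labels_run_closed[OF assms] assms delta_closed(2)
  unfolding trans_relab[OF assms(2)] labels_run_def by blast

text \<open>\<open>E\<close> occurs only below modalities, so only states at earlier positions are
  inspected. The disjunction reflects that the initial state can be the previous state in two ways:
  at the start of the run, or by being reached again.\<close>

fun trans_form :: "('q \<Rightarrow> 'a form) \<Rightarrow> 'q \<times> 'q memory \<times> 'a \<times> marking \<Rightarrow> 'a form" where
  "trans_form E (q, m, a, t) =
     And (Or (Mod (step_mod d) (E q)) (if q = init A then Atom (start_atom d) else bot_form))
       (And (case m of State r \<Rightarrow> Mod (class_mod d) (E r) | _ \<Rightarrow> Atom (class_start_atom d))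
         (And (Var (va a)) (mark_form t)))"

text \<open>A test \<open>R\<close> of the new state yields the state formulas, a test of the output
  letter the output formulas.\<close>

definition result_form ::
  "('q \<times> 'a \<Rightarrow> bool) \<Rightarrow> ('q \<Rightarrow> 'a form) \<Rightarrow> 'a form" where
  "result_form R E = big_or (trans_form E)
     {(q, m, a, t). (q, m, a, t) \<in> states A \<times> memories \<times> in_alphabet A \<times> UNIV \<and> R (delta A q m a t)}"

lemma finite_result: "finite {(q, m, a, t). (q, m, a, t) \<in> states A \<times> memories \<times> in_alphabet A \<times> UNIV
    \<and> R (delta A q m a t)}"
  by (rule finite_subset[OF _ finite_sets(5)]) auto

lemma dir_form_result_form:
  assumes "\<And>q. q \<in> states A \<Longrightarrow> dir_form d F (E q)" "va ` in_alphabet A \<subseteq> F"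
  shows "dir_form d F (result_form R E)"
  unfolding result_form_def
proof (rule dir_form_big_or[OF finite_result], clarify)
  fix q m a and t :: marking
  assume q: "q \<in> states A" and m: "m \<in> memories" and a: "a \<in> in_alphabet A"
  have "dir_form d F (case m of State r \<Rightarrow> Mod (class_mod d) (E r) | _ \<Rightarrow> Atom (class_start_atom d))"
    using m assms(1) by (cases m) auto
  moreover have "va a \<in> F" using a assms(2) by blast
  ultimately show "dir_form d F (trans_form E (q, m, a, t))" using assms(1)[OF q] by simp
qed

text \<open>Correctness of \<open>E\<close> is assumed only at positions processed before
  \<open>i\<close>; this is as much as an induction along the run can provide.\<close>

lemma sem_result_form:
  assumes run: "labels_run w lab s" and i: "i < length w"
    and V: "letter_valuation va (in_alphabet A) (length w) lab V"
    and E: "\<And>r j. r \<in> states A \<Longrightarrow> j < length w \<Longrightarrow> rank d (length w) j < rank d (length w) i \<Longrightarrow>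
      j \<in> sem w V (E r) \<longleftrightarrow> s j = r"
  shows "i \<in> sem w V (result_form R E) \<longleftrightarrow> R (trans d A (relab w lab) s i)"
proof -
  have E': "j \<in> sem w V (E r) \<longleftrightarrow> s j = r"
    if "r \<in> states A" "m \<in> dir_mods d" "target w m i = Some j" for r m j
    using E target_rank_less[OF i that(2,3)] target_less_length[OF i that(3)] that(1) by blast
  have tr: "i \<in> sem w V (trans_form E (q, m, a, t)) \<longleftrightarrow>
      q = previous_state w s i \<and> m = memory_at w s i \<and> a = lab i \<and> t = tp w i"
    if q: "q \<in> states A" and m: "m \<in> memories" and a: "a \<in> in_alphabet A" for q m a t
  proof -
    have "i \<in> sem w V (Or (Mod (step_mod d) (E q)) (if q = init A then Atom (start_atom d) else bot_form))
        \<longleftrightarrow> q = previous_state w s i"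
      using i E'[OF q, of "step_mod d"] by (auto simp: atom_holds_start split: option.split)
    moreover have "i \<in> sem w V (case m of State r \<Rightarrow> Mod (class_mod d) (E r) | _ \<Rightarrow> Atom (class_start_atom d))
        \<longleftrightarrow> m = memory_at w s i"
    proof (cases "\<exists>r. m = State r")
      case True
      then obtain r where r: "m = State r" "r \<in> states A" using m by auto
      then show ?thesis using i E'[OF r(2), of "class_mod d"] by (auto split: option.split)
    next
      case False
      then have e: "m = empty_memory d" using m by auto
      have "(case m of State r \<Rightarrow> Mod (class_mod d) (E r) | _ \<Rightarrow> Atom (class_start_atom d))
          = Atom (class_start_atom d)"
        using False by (simp split: memory.split)
      then show ?thesis using i by (simp add: atom_holds_start e split: option.split)
    qed
    moreover have "i \<in> sem w V (Var (va a)) \<longleftrightarrow> a = lab i"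
      using V a i by (auto simp: letter_valuation_def)
    ultimately show ?thesis using i by simp
  qed
  have closed: "previous_state w s i \<in> states A" "memory_at w s i \<in> memories" "lab i \<in> in_alphabet A"
    using labels_run_closed[OF run i] run i by (simp_all add: labels_run_def)
  have "i \<in> sem w V (result_form R E) \<longleftrightarrow> (\<exists>q m a t. q \<in> states A \<and> m \<in> memories \<and> a \<in> in_alphabet A \<and>
      R (delta A q m a t) \<and> i \<in> sem w V (trans_form E (q, m, a, t)))"
    unfolding result_form_def sem_big_or[OF finite_result] by (simp del: trans_form.simps)
  also have "\<dots> \<longleftrightarrow> (\<exists>q m a t. q \<in> states A \<and> m \<in> memories \<and> a \<in> in_alphabet A \<and> R (delta A q m a t) \<and>
      q = previous_state w s i \<and> m = memory_at w s i \<and> a = lab i \<and> t = tp w i)"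
    using tr by (intro ex_cong1 conj_cong refl) blast+
  also have "\<dots> \<longleftrightarrow> R (delta A (previous_state w s i) (memory_at w s i) (lab i) (tp w i))"
    using closed by (simp del: insert_iff split_paired_Ex)
  finally show ?thesis unfolding trans_relab[OF i] .
qed

text \<open>Mutual recursion between the states is eliminated by nesting: \<open>B\<close> is the set of states whose
  variables are bound further outside. Since the modalities strictly decrease the rank, the fixpoint
  is unique and it does not matter which states are bound first.\<close>

lemma state_forms:
  assumes "B \<subseteq> states A"
  shows "\<exists>E. \<forall>q \<in> states A. dir_form d (vs ` B \<union> va ` in_alphabet A) (E q) \<and>
    (\<forall>(w :: ('a, 'd) data_word) lab s V. labels_run w lab s \<longrightarrow>
      letter_valuation va (in_alphabet A) (length w) lab V \<longrightarrow>
      (\<forall>r \<in> B. V (vs r) = {i. i < length w \<and> s i = r}) \<longrightarrow>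
      sem w V (E q) = {i. i < length w \<and> s i = q})"
  using assms
proof (induction "card (states A - B)" arbitrary: B rule: less_induct)
  case less
  let ?F = "\<lambda>B. vs ` B \<union> va ` in_alphabet A"
  let ?good = "\<lambda>B q \<phi>. dir_form d (?F B) \<phi> \<and>
    (\<forall>(w :: ('a, 'd) data_word) lab s V. labels_run w lab s \<longrightarrow>
      letter_valuation va (in_alphabet A) (length w) lab V \<longrightarrow>
      (\<forall>r \<in> B. V (vs r) = {i. i < length w \<and> s i = r}) \<longrightarrow>
      sem w V \<phi> = {i. i < length w \<and> s i = q})"
  have "\<exists>\<phi>. ?good B q \<phi>" if q: "q \<in> states A" for q
  proof (cases "q \<in> B")
    case True
    then show ?thesis by (intro exI[of _ "Var (vs q)"]) auto
  next
    case False
    \<comment> \<open>The formulas inside the binder may also use the variable of \<open>q\<close>,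
      so fewer states remain to be described by fixpoints.\<close>
    have "card (states A - insert q B) < card (states A - B)"
      by (rule psubset_card_mono) (use False q finite_sets in auto)
    then obtain E where E: "\<forall>r \<in> states A. ?good (insert q B) r (E r)"
      using less.hyps[of "insert q B"] less.prems q by blast
    let ?body = "result_form (\<lambda>(q', _). q' = q) E"
    show ?thesis
    proof (intro exI[of _ "Mu (vs q) ?body"] conjI allI impI)
      have "dir_form d (insert (vs q) (?F B)) ?body"
        by (rule dir_form_result_form) (use E in auto)
      then show "dir_form d (?F B) (Mu (vs q) ?body)" by simp
      fix w :: "('a, 'd) data_word" and lab s V
      assume run: "labels_run w lab s" and V: "letter_valuation va (in_alphabet A) (length w) lab V"
        and B: "\<forall>r \<in> B. V (vs r) = {i. i < length w \<and> s i = r}"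
      let ?X = "{i. i < length w \<and> s i = q}" and ?L = "sem w V (Mu (vs q) ?body)"
      have V': "letter_valuation va (in_alphabet A) (length w) lab (V(vs q := X))" for X
        using V q vs_va by (auto simp: letter_valuation_def)
      have B': "\<forall>r \<in> insert q B. (V(vs q := ?X)) (vs r) = {i. i < length w \<and> s i = r}"
        using B q less.prems inj_vs False by (auto simp: inj_on_def)
      have EX: "sem w (V(vs q := ?X)) (E r) = {i. i < length w \<and> s i = r}" if "r \<in> states A" for r
        using E that run V' B' by blast
      have s: "s i = fst (trans d A (relab w lab) s i)" if "i < length w" for i
        using run that by (simp add: labels_run_def)
      have "i \<in> ?X" if "i \<in> sem w (V(vs q := ?X)) ?body" for i
      proof -
        have i: "i < length w" using that by (rule sem_less_length)
        have "case trans d A (relab w lab) s i of (q', _) \<Rightarrow> q' = q"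
          using that by (subst (asm) sem_result_form[OF run i V']) (auto simp: EX)
        then show ?thesis using i s[OF i] by (simp add: case_prod_beta)
      qed
      \<comment> \<open>The true set of positions in state \<open>q\<close> is a prefixed point and
        thus contains the least one.\<close>
      then have LX: "?L \<subseteq> ?X" unfolding sem.simps by (intro lfp_lowerbound) blast
      \<comment> \<open>Conversely, before \<open>i\<close> the two candidates for
        \<open>vs q\<close> agree, by \<open>LX\<close> and the induction hypothesis, and the value
        of the body at \<open>i\<close> depends on \<open>vs q\<close> only there.\<close>
      have XL: "i \<in> ?X \<Longrightarrow> i \<in> ?L" for i
      proof (induction "rank d (length w) i" arbitrary: i rule: less_induct)
        case (less i)
        let ?D = "{k. rank d (length w) k < rank d (length w) i}"
        have i: "i < length w" using less.prems by simp
        have EL: "j \<in> sem w (V(vs q := ?L)) (E r) \<longleftrightarrow> s j = r"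
          if r: "r \<in> states A" and j: "j < length w" "rank d (length w) j < rank d (length w) i" for r j
        proof -
          have "j \<in> sem w (V(vs q := ?L)) (E r) \<longleftrightarrow> j \<in> sem w (V(vs q := ?X)) (E r)"
          proof (rule sem_local[where D = ?D])
            show "l \<in> ?D" if "m \<in> modalities (E r)" "k \<in> ?D" "k < length w" "target w m k = Some l" for m k l
            proof -
              have "m \<in> dir_mods d" using E r that(1) unfolding dir_form_def by blast
              then show ?thesis using rank_closed[of m d k w] that by blast
            qed
            show "k \<in> (V(vs q := ?L)) x \<longleftrightarrow> k \<in> (V(vs q := ?X)) x" if "k \<in> ?D" for k x
              using less.hyps[of k] LX that by auto
            show "j \<in> ?D" using j by simp
          qed
          then show ?thesis using EX[OF r] j by simp
        qed
        have "case trans d A (relab w lab) s i of (q', _) \<Rightarrow> q' = q"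
          using s[OF i] less.prems by (simp add: case_prod_beta)
        then have "i \<in> sem w (V(vs q := ?L)) ?body"
          by (subst sem_result_form[OF run i V']) (auto simp: EL simp del: sem.simps)
        then show ?case using sem_Mu_unfold[of w V "vs q" ?body] by blast
      qed
      show "?L = ?X" using LX XL by blast
    qed
  qed
  then show ?case by (rule bchoice[rule_format])
qed

text \<open>Taking \<open>B\<close> empty in \<open>state_forms\<close> leaves no state variable
  free. Success turns into a condition on each position, which bites only where the run, or its
  trace in a class, ends.\<close>

lemma output_and_check_forms:
  "\<exists>out chk. (\<forall>a. dir_form d (va ` in_alphabet A) (out a)) \<and> dir_form d (va ` in_alphabet A) chk \<and>
    (\<forall>(w :: ('a, 'd) data_word) lab s V. labels_run w lab s \<longrightarrow>
      letter_valuation va (in_alphabet A) (length w) lab V \<longrightarrow>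
      (\<forall>a. sem w V (out a) = {i. i < length w \<and> snd (trans d A (relab w lab) s i) = a}) \<and>
      ((\<forall>i < length w. i \<in> sem w V chk) \<longleftrightarrow> success d A (relab w lab) s))"
proof -
  obtain E where E: "\<forall>q \<in> states A. dir_form d (vs ` {} \<union> va ` in_alphabet A) (E q) \<and>
    (\<forall>(w :: ('a, 'd) data_word) lab s V. labels_run w lab s \<longrightarrow>
      letter_valuation va (in_alphabet A) (length w) lab V \<longrightarrow>
      (\<forall>r \<in> {}. V (vs r) = {i. i < length w \<and> s i = r}) \<longrightarrow>
      sem w V (E q) = {i. i < length w \<and> s i = q})"
    using state_forms[OF empty_subsetI] by (rule exE)
  define out where "out a = result_form (\<lambda>(_, a'). a' = a) E" for a
  \<comment> \<open>A run in direction \<open>d\<close> ends where the opposite direction starts.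
    Testing this by atoms instead of modalities keeps \<open>chk\<close> within
    \<open>dir_mods d\<close>.\<close>
  define chk where "chk = And (Or (NegAtom (start_atom (opp d))) (big_or E (global_final A)))
    (Or (NegAtom (class_start_atom (opp d))) (big_or E (class_final A)))"
  have final: "global_final A \<subseteq> states A" "class_final A \<subseteq> states A" using cmt by (auto simp: is_cmt_def)
  have Ed: "dir_form d (va ` in_alphabet A) (E q)" if "q \<in> states A" for q using E that by simp
  have "dir_form d (va ` in_alphabet A) (out a)" for a
    unfolding out_def by (rule dir_form_result_form) (use Ed in auto)
  moreover have "dir_form d (va ` in_alphabet A) chk"
  proof -
    have "dir_form d (va ` in_alphabet A) (big_or E F)" if "F \<subseteq> states A" "finite F" for F
      using that Ed by (intro dir_form_big_or) auto
    from this[OF final(1) finite_sets(4)] this[OF final(2) finite_sets(3)] show ?thesis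
      by (simp add: chk_def)
  qed
  moreover have "(\<forall>a. sem w V (out a) = {i. i < length w \<and> snd (trans d A (relab w lab) s i) = a}) \<and>
      ((\<forall>i < length w. i \<in> sem w V chk) \<longleftrightarrow> success d A (relab w lab) s)"
    if run: "labels_run w lab s" and V: "letter_valuation va (in_alphabet A) (length w) lab V"
    for w :: "('a, 'd) data_word" and lab s V
  proof -
    have Es: "sem w V (E q) = {i. i < length w \<and> s i = q}" if "q \<in> states A" for q
      using E that run V by blast
    have "i \<in> sem w V (out a) \<longleftrightarrow> snd (trans d A (relab w lab) s i) = a" if i: "i < length w" for a i
      unfolding out_def by (subst sem_result_form[OF run i V]) (auto simp: Es case_prod_beta)
    then have "sem w V (out a) = {i. i < length w \<and> snd (trans d A (relab w lab) s i) = a}" for a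
      using sem_less_length[of _ w V "out a"] by (intro set_eqI) auto
    moreover have "i \<in> sem w V chk \<longleftrightarrow>
      (target w (step_mod (opp d)) i = None \<longrightarrow> s i \<in> global_final A) \<and>
      (target w (class_mod (opp d)) i = None \<longrightarrow> s i \<in> class_final A)" if i: "i < length w" for i
    proof -
      have "i \<in> sem w V (big_or E F) \<longleftrightarrow> s i \<in> F" if "F \<subseteq> states A" "finite F" for F
        using Es i that by (auto simp: sem_big_or)
      from this[OF final(1) finite_sets(4)] this[OF final(2) finite_sets(3)] show ?thesis
        using i by (cases "target w (step_mod (opp d)) i"; cases "target w (class_mod (opp d)) i")
          (simp_all add: chk_def atom_holds_start)
    qed
    ultimately show ?thesis by (simp add: success_def)
  qed
  ultimately show ?thesis by (intro exI[of _ out] exI[of _ chk] conjI allI impI) simp_all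
qed

end

section \<open>Checking all positions, and induction along the cascade\<close>

definition always_form :: "'a form" where
  "always_form = Nu 0 (And (Var 1) (Or (Atom LastG) (Mod Xg (Var 0))))"

lemma sem_always_form:
  assumes "w \<noteq> []"
  shows "0 \<in> sem w V always_form \<longleftrightarrow> (\<forall>i < length w. i \<in> V 1)"
proof
  assume "0 \<in> sem w V always_form"
  moreover define G where "G = sem w V always_form"
  ultimately have 0: "0 \<in> G" by simp
  have G: "G = sem w (V(0 := G)) (And (Var 1) (Or (Atom LastG) (Mod Xg (Var 0))))"
    unfolding G_def always_form_def by (rule sem_Nu_unfold)
  have unfold: "i \<in> V 1 \<and> (i + 1 < length w \<longrightarrow> i + 1 \<in> G)" if "i \<in> G" for i
  proof -
    have "i \<in> sem w (V(0 := G)) (And (Var 1) (Or (Atom LastG) (Mod Xg (Var 0))))"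
      using that G by blast
    then show ?thesis by (auto split: if_splits)
  qed
  have "i < length w \<Longrightarrow> i \<in> G" for i
  proof (induction i)
    case (Suc i)
    then show ?case using unfold[of i] by simp
  qed (rule 0)
  then show "\<forall>i < length w. i \<in> V 1" using unfold by blast
next
  assume "\<forall>i < length w. i \<in> V 1"
  then have "{..<length w} \<subseteq> sem w V always_form"
    unfolding always_form_def sem.simps by (intro gfp_upperbound) auto
  then show "0 \<in> sem w V always_form" using assms by auto
qed

text \<open>The induction must speak about the later words of a cascade, over which no formula is
  evaluated. Such a word is represented by sentences \<open>\<phi> a\<close> over the original word,
  one for each letter; passing a transducer replaces them by sentences for its output letters, one
  level higher.\<close>

lemma formula_for_cascade_continuation:
  fixes lab :: "('a, 'd) data_word \<Rightarrow> nat \<Rightarrow> 'a" and C :: "('a, 'q) cascade"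
  assumes "is_cascade \<Gamma> C"
    and "\<And>a. a \<in> \<Gamma> \<Longrightarrow> \<phi> a \<in> Comp_level l (BR_base \<Sigma>)"
    and "\<And>w i. w \<in> data_words \<Sigma> \<Longrightarrow> i < length w \<Longrightarrow> lab w i \<in> \<Gamma>"
    and "\<And>w a. w \<in> data_words \<Sigma> \<Longrightarrow> a \<in> \<Gamma> \<Longrightarrow> sem w (\<lambda>_. {}) (\<phi> a) = {i. i < length w \<and> lab w i = a}"
  shows "\<exists>\<chi> l'. \<chi> \<in> Comp_level l' (BR_base \<Sigma>) \<and>
    (\<forall>w \<in> data_words \<Sigma>. models w \<chi> \<longleftrightarrow> accepts C (relab w (lab w)))"
  using assms
proof (induction C arbitrary: \<Gamma> \<phi> l lab)
  case Nil
  let ?\<psi> = "Or (Atom FirstG) (NegAtom FirstG)"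
  have "subst Var ?\<psi> \<in> Comp_level (Suc 0) (BR_base \<Sigma>)"
    by (rule Comp_level_SucI) (auto simp: Formulas_def)
  moreover have "models w (subst Var ?\<psi>)" if "w \<in> data_words \<Sigma>" for w :: "('a, 'd) data_word"
    using that by (auto simp: models_def data_words_def)
  ultimately show ?case unfolding accepts.simps by blast
next
  case (Cons dA C)
  obtain d A where dA: "dA = (d, A)" by (cases dA)
  have cmt: "is_cmt A" and \<Gamma>: "in_alphabet A = \<Gamma>" and C: "is_cascade (out_alphabet A) C"
    using Cons.prems(1) by (auto simp: dA)
  have "finite \<Gamma>" "finite (states A)" using cmt \<Gamma> by (auto simp: is_cmt_def)
  then obtain ka :: "'a \<Rightarrow> nat" and kq :: "'q \<Rightarrow> nat" where k: "inj_on ka \<Gamma>" "inj_on kq (states A)"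
    using finite_imp_inj_to_nat_seg by metis
  \<comment> \<open>Even numbers name letters and odd numbers name states, which keeps the two
    families of variables disjoint.\<close>
  define va where "va a = 2 * ka a" for a
  define vs where "vs q = 2 * kq q + 1" for q
  have inj_\<Gamma>: "inj_on va \<Gamma>" using k(1) by (auto simp: va_def inj_on_def)
  interpret transducer A d vs va
  proof
    show "inj_on vs (states A)" using k(2) by (auto simp: vs_def inj_on_def)
    show "vs ` states A \<inter> va ` in_alphabet A = {}" by (auto simp: vs_def va_def) presburger
  qed (use cmt inj_\<Gamma> \<Gamma> in auto)
  obtain out chk where out_chk: "(\<forall>a. dir_form d (va ` \<Gamma>) (out a)) \<and> dir_form d (va ` \<Gamma>) chk \<and>
    (\<forall>(w :: ('a, 'd) data_word) lab s V. labels_run w lab s \<longrightarrow>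
      letter_valuation va \<Gamma> (length w) lab V \<longrightarrow>
      (\<forall>a. sem w V (out a) = {i. i < length w \<and> snd (trans d A (relab w lab) s i) = a}) \<and>
      ((\<forall>i < length w. i \<in> sem w V chk) \<longleftrightarrow> success d A (relab w lab) s))"
    using output_and_check_forms[where 'd = 'd] unfolding \<Gamma> by (elim exE) (rule that)
  have out: "dir_form d (va ` \<Gamma>) (out a)" and chk: "dir_form d (va ` \<Gamma>) chk" for a
    using out_chk by simp_all
  have sem: "(\<forall>a. sem w V (out a) = {i. i < length w \<and> snd (trans d A (relab w lab) s i) = a}) \<and>
      ((\<forall>i < length w. i \<in> sem w V chk) \<longleftrightarrow> success d A (relab w lab) s)"
    if "labels_run w lab s" "letter_valuation va \<Gamma> (length w) lab V"
    for w :: "('a, 'd) data_word" and lab s V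
    using out_chk that by blast
  \<comment> \<open>The variable of an input letter is replaced by the sentence that already
    describes where this letter stands.\<close>
  define \<sigma> where "\<sigma> x = \<phi> (inv_into \<Gamma> va x)" for x
  have \<sigma>_va: "\<sigma> (va a) = \<phi> a" if "a \<in> \<Gamma>" for a using inj_\<Gamma> that by (simp add: \<sigma>_def)
  have \<sigma>: "\<forall>x \<in> free_vars \<psi>. \<sigma> x \<in> Comp_level l (BR_base \<Sigma>)" if "dir_form d (va ` \<Gamma>) \<psi>" for \<psi>
    using that \<sigma>_va Cons.prems(2) by (auto simp: dir_form_def)
  have level: "subst \<sigma> \<psi> \<in> Comp_level (Suc l) (BR_base \<Sigma>)" if "dir_form d (va ` \<Gamma>) \<psi>" for \<psi>
    using \<sigma>[OF that] dir_form_BR_base[OF that] by (intro Comp_level_SucI) blast+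
  have "\<exists>s. \<forall>i < length w. s i = fst (trans d A (relab w (lab w)) s i)" for w :: "('a, 'd) data_word"
    using trans_exists[of "relab w (lab w)" d A] by simp
  then obtain s where s: "\<And>(w :: ('a, 'd) data_word) i. i < length w \<Longrightarrow>
      s w i = fst (trans d A (relab w (lab w)) (s w) i)"
    by metis
  define lab' where "lab' w i = snd (trans d A (relab w (lab w)) (s w) i)" for w i
  have run: "labels_run w (lab w) (s w)" if "w \<in> data_words \<Sigma>" for w
    using s Cons.prems(3)[OF that] \<Gamma> by (simp add: labels_run_def)
  have V: "letter_valuation va \<Gamma> (length w) (lab w) (\<lambda>z. sem w (\<lambda>_. {}) (\<sigma> z))"
    if "w \<in> data_words \<Sigma>" for w
    using Cons.prems(4)[OF that] by (simp add: letter_valuation_def \<sigma>_va)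
  have "\<exists>\<chi> l'. \<chi> \<in> Comp_level l' (BR_base \<Sigma>) \<and>
      (\<forall>w \<in> data_words \<Sigma>. models w \<chi> \<longleftrightarrow> accepts C (relab w (lab' w)))"
  proof (rule Cons.IH[OF C])
    show "subst \<sigma> (out a) \<in> Comp_level (Suc l) (BR_base \<Sigma>)" for a using level[OF out] .
    show "lab' w i \<in> out_alphabet A" if "w \<in> data_words \<Sigma>" "i < length w" for w i
      unfolding lab'_def by (rule labels_run_out[OF run[OF that(1)] that(2)])
    show "sem w (\<lambda>_. {}) (subst \<sigma> (out a)) = {i. i < length w \<and> lab' w i = a}"
      if "w \<in> data_words \<Sigma>" for w a
      using sem[OF run[OF that] V[OF that]] unfolding sem_subst_Comp[OF \<sigma>[OF out]] lab'_def by blast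
  qed
  then obtain \<chi> l' where \<chi>: "\<chi> \<in> Comp_level l' (BR_base \<Sigma>)"
    "\<And>w. w \<in> data_words \<Sigma> \<Longrightarrow> models w \<chi> \<longleftrightarrow> accepts C (relab w (lab' w))" by blast
  \<comment> \<open>\<open>chk\<close> may use past modalities while \<open>always_form\<close> uses
    \<open>Xg\<close>; one more composition level permits the mixture.\<close>
  define chk' where "chk' = subst (\<lambda>_. subst \<sigma> chk) always_form"
  have always: "\<forall>x \<in> free_vars always_form. subst \<sigma> chk \<in> Comp_level (Suc l) (BR_base \<Sigma>)"
    using level[OF chk] by blast
  have chk'_level: "chk' \<in> Comp_level (Suc (Suc l)) (BR_base \<Sigma>)"
    unfolding chk'_def by (rule Comp_level_SucI) (use level[OF chk] in \<open>auto simp: always_form_def Formulas_def\<close>)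
  have chk': "models w chk' \<longleftrightarrow> success d A (relab w (lab w)) (s w)" if w: "w \<in> data_words \<Sigma>" for w
  proof -
    have "models w chk' \<longleftrightarrow> (\<forall>i < length w. i \<in> sem w (\<lambda>_. {}) (subst \<sigma> chk))"
      unfolding models_def chk'_def sem_subst_Comp[OF always]
      using w by (intro sem_always_form) (simp add: data_words_def)
    then show ?thesis using sem[OF run[OF w] V[OF w]] unfolding sem_subst_Comp[OF \<sigma>[OF chk]] by blast
  qed
  \<comment> \<open>Formulas substituted in one step must come from a common level, so both
    conjuncts are lifted to the larger one.\<close>
  let ?l = "max (Suc (Suc l)) l'"
  define \<tau> where "\<tau> x = (if x = 0 then chk' else \<chi>)" for x :: nat
  have \<tau>: "\<tau> x \<in> Comp_level ?l (BR_base \<Sigma>)" for x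
    using chk'_level \<chi>(1) Comp_level_mono[of "Suc (Suc l)" ?l "BR_base \<Sigma>"]
      Comp_level_mono[of l' ?l "BR_base \<Sigma>"] by (auto simp: \<tau>_def)
  have "subst \<tau> (And (Var 0) (Var 1)) \<in> Comp_level (Suc ?l) (BR_base \<Sigma>)"
    by (rule Comp_level_SucI) (use \<tau> in \<open>auto simp: Formulas_def\<close>)
  moreover have "models w (subst \<tau> (And (Var 0) (Var 1))) \<longleftrightarrow> accepts (dA # C) (relab w (lab w))"
    if w: "w \<in> data_words \<Sigma>" for w
  proof -
    have "accepts (dA # C) (relab w (lab w)) \<longleftrightarrow>
      success d A (relab w (lab w)) (s w) \<and> accepts C (relab (relab w (lab w)) (lab' w))"
      unfolding dA by (rule accepts_Cons_iff) (use w s in \<open>auto simp: data_words_def lab'_def prod_eq_iff\<close>)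
    then show ?thesis using chk'[OF w] \<chi>(2)[OF w] by (simp add: models_def \<tau>_def)
  qed
  ultimately show ?case by blast
qed

lemma formula_for_cascade:
  assumes "C \<in> (cascades \<Sigma> :: ('a, 'q) cascade set)"
  shows "\<exists>\<phi> \<in> BR \<Sigma>. sentence \<phi> \<and>
    (\<forall>w \<in> (data_words \<Sigma> :: ('a, 'd) data_word set). models w \<phi> \<longleftrightarrow> accepts C w)"
proof -
  have "\<exists>\<chi> l'. \<chi> \<in> Comp_level l' (BR_base \<Sigma>) \<and>
    (\<forall>w \<in> (data_words \<Sigma> :: ('a, 'd) data_word set).
      models w \<chi> \<longleftrightarrow> accepts C (relab w (\<lambda>i. fst (w ! i))))"
  proof (rule formula_for_cascade_continuation)
    show "is_cascade \<Sigma> C" using assms by (simp add: cascades_def)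
    show "subst Var (Atom (Letter a)) \<in> Comp_level (Suc 0) (BR_base \<Sigma>)" if "a \<in> \<Sigma>" for a
      by (rule Comp_level_SucI) (use that in \<open>auto simp: Formulas_def\<close>)
  qed (auto simp: data_words_def)
  then obtain \<chi> l where \<chi>: "\<chi> \<in> Comp_level l (BR_base \<Sigma>)"
    "\<forall>w \<in> (data_words \<Sigma> :: ('a, 'd) data_word set). models w \<chi> \<longleftrightarrow> accepts C w"
    unfolding relab_id by (elim exE conjE)
  have "\<chi> \<in> BR \<Sigma>" using \<chi>(1) unfolding BR_def Comp_def by blast
  moreover have "sentence \<chi>" using Comp_level_sentence[OF \<chi>(1)] by (simp add: sentence_def)
  ultimately show ?thesis using \<chi>(2) by blast
qed

theorem theorem9:
  fixes \<Sigma> :: "'a set"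
  assumes "infinite (UNIV :: 'a set)"
    and "infinite (UNIV :: 'q set)"
    and "infinite (UNIV :: 'd set)"
    and "finite \<Sigma>"
  shows "(\<forall>\<phi> \<in> BR \<Sigma>. sentence \<phi> \<longrightarrow>
            (\<exists>C \<in> (cascades \<Sigma> :: ('a, 'q) cascade set).
               \<forall>w \<in> (data_words \<Sigma> :: ('a, 'd) data_word set). accepts C w \<longleftrightarrow> models w \<phi>))
       \<and> (\<forall>C \<in> (cascades \<Sigma> :: ('a, 'q) cascade set).
            \<exists>\<phi> \<in> BR \<Sigma>. sentence \<phi> \<and>
               (\<forall>w \<in> (data_words \<Sigma> :: ('a, 'd) data_word set). models w \<phi> \<longleftrightarrow> accepts C w))"
proof -
  obtain e :: "nat \<Rightarrow> 'a" where "inj e"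
    using infinite_countable_subset[OF assms(1)] by blast
  moreover obtain c :: "nat \<Rightarrow> 'q" where "inj c"
    using infinite_countable_subset[OF assms(2)] by blast
  ultimately interpret coding e c \<Sigma> using assms(4) by unfold_locales
  show ?thesis
    by (intro conjI ballI impI) (rule cascade_for_formula, assumption, rule formula_for_cascade, assumption)
qed

end
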